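(* Suppose that all quadrature states at time level $t^n$ and all exterior boundary traces belong to $\mathcal G_{B_{\rm const}}$, and that the interface wave speeds satisfy, at every interface, $$a^-<\min\{0,\alpha_l(\mathbf U^-,\mathbf U^+;\mathbf e_1)\},\qquad a^+>\max\{0,\alpha_r(\mathbf U^+,\mathbf U^-;\mathbf e_1)\},$$ and, at every interface and for every $1\le r\le M$, both $$d_r^->0\ \text{ or }\ (\widehat{\mathbf F}_1,\widehat q_r)=(\mathbf F_1(\mathbf U^-),q_r(\mathbf U^-)),$$ $$d_r^+>0\ \text{ or }\ (\widehat{\mathbf F}_1,\widehat q_r)=(\mathbf F_1(\mathbf U^+),q_r(\mathbf U^+)).$$ Then for every $0<\lambda\le\lambda_*^{\rm rel}$, where $$\lambda_*^{\rm rel}:=\min_{1\le j\le N_x}\Big\{\lambda_j^0,\ \frac{\widehat\omega_1}{\mathfrak c_{j,L}},\ \frac{\widehat\omega_1}{\mathfrak c_{j,R}}\Big\}$$ (division by zero interpreted as $+\infty$), the cell-average update $\overline{\mathbf U}_j^{n+1}=\overline{\mathbf U}_j^n-\lambda(\widehat{\mathbf F}_{1,j+1/2}-\widehat{\mathbf F}_{1,j-1/2})$ is weakly multi-entropy stable: for every $1\le j\le N_x$ and every $1\le r\le M$, $$\overline{\mathbf U}_j^{n+1}\in\mathcal G_{B_{\rm const}},\qquad \eta_r(\overline{\mathbf U}_j^{n+1})\le\mathcal B_{j,r}^n .$$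
   Context: **States, flux, entropies.** Fix $\gamma>1$. A state is $\mathbf U=(\rho,\mathbf m^\top,\mathbf B^\top,E)^\top\in\mathbb R^8$ with $\mathbf m,\mathbf B\in\mathbb R^3$; $\mathbf v=\mathbf m/\rho$, $p=(\gamma-1)(E-\frac{|\mathbf m|^2}{2\rho}-\frac{|\mathbf B|^2}{2})$, $p_{\rm tot}=p+\frac{|\mathbf B|^2}2$. Admissible set $\mathcal G=\{\mathbf U:\rho>0,\ E-\frac{|\mathbf m|^2}{2\rho}-\frac{|\mathbf B|^2}{2}>0\}$. For fixed $B_{\rm const}\in\mathbb R$, $\mathcal G_{B_{\rm const}}=\{\mathbf U\in\mathcal G:B_1=B_{\rm const}\}$. The flux is $\mathbf F_1(\mathbf U)=(\rho v_1,(v_1\mathbf m-B_1\mathbf B+p_{\rm tot}\mathbf e_1)^\top,(v_1\mathbf B-B_1\mathbf v)^\top,v_1(E+p_{\rm tot})-B_1(\mathbf v\cdot\mathbf B))^\top$, $\mathbf e_1=(1,0,0)^\top$. Let $f_1,\dots,f_M\in C^2(\mathbb R)$ satisfy $f_r'>0$ and $f_r'-\gamma f_r''>0$ on $\mathbb R$; with $s=\log p-\gamma\log\rho$ set $\eta_r(\mathbf U)=-\rho f_r(s)$, $q_r(\mathbf U)=v_1\eta_r(\mathbf U)$ on $\mathcal G$. Write $[z]_+=\max\{z,0\}$. **Splitting speeds.** For $\mathbf U,\widetilde{\mathbf U}\in\mathcal G$ and a unit vector $\xi$: $\mathcal C(\mathbf U;\xi)=\frac1{\sqrt2}\Big[\mathcal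 C_s^2+\frac{|\mathbf B|^2}\rho+\sqrt{(\mathcal C_s^2+\frac{|\mathbf B|^2}\rho)^2-4\frac{\mathcal C_s^2(\xi\cdot\mathbf B)^2}{\rho}}\Big]^{1/2}$, $\mathcal C_s^2=\frac{(\gamma-1)p}{2\rho}$. With $\widehat{\mathbf v}=\frac{\sqrt\rho\mathbf v+\sqrt{\tilde\rho}\tilde{\mathbf v}}{\sqrt\rho+\sqrt{\tilde\rho}}$ and $\mathfrak b=\frac{|\mathbf B-\widetilde{\mathbf B}|}{\sqrt\rho+\sqrt{\tilde\rho}}$, $\alpha_r(\mathbf U,\widetilde{\mathbf U};\xi)=\max\{\mathbf v\cdot\xi,\widehat{\mathbf v}\cdot\xi\}+\mathcal C(\mathbf U;\xi)+\mathfrak b$, $\alpha_l(\mathbf U,\widetilde{\mathbf U};\xi)=\min\{\mathbf v\cdot\xi,\widehat{\mathbf v}\cdot\xi\}-\mathcal C(\mathbf U;\xi)-\mathfrak b$, $\alpha_\star(\mathbf U,\widetilde{\mathbf U};\xi)=\max\{|\mathbf v\cdot\xi|,|\widehat{\mathbf v}\cdot\xi|\}+\mathcal C(\mathbf U;\xi)+\mathfrak b$. **Mesh and data.** Uniform cells $I_j=[x_{j-1/2},x_{j+1/2}]$, $1\le j\le N_x$, width $\Delta x$. On each cell $\mathbf U_j^n\in[\mathbb P^k(I_j)]^8$ ($k\ge0$) with $B_{1,j}^n\equiv B_{\rm const}$. Use the $L$-point Gauss–Lobatto rule on $I_j$ with $L\ge2$, $2L-3\ge k$, nodes $\widehat x_j^{[\alpha]}$,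 weights $\widehat\omega_\alpha>0$, $\sum_\alpha\widehat\omega_\alpha=1$, $\widehat\omega_1=\widehat\omega_L=\frac1{L(L-1)}$. (For $k=0$ take $L=2$.) Quadrature states: $\widehat{\mathbf U}_j^{[\alpha]}=\mathbf U_j^n(\widehat x_j^{[\alpha]})$; $\overline{\mathbf U}_j^n=\sum_\alpha\widehat\omega_\alpha\widehat{\mathbf U}_j^{[\alpha]}$ is the cell average; $\mathbf U_{j,L}=\widehat{\mathbf U}_j^{[1]}=\mathbf U_{j-1/2}^+$, $\mathbf U_{j,R}=\widehat{\mathbf U}_j^{[L]}=\mathbf U_{j+1/2}^-$. At interface $x_{j+1/2}$ ($0\le j\le N_x$) the traces are $\mathbf U^-=\mathbf U_{j+1/2}^-$ and $\mathbf U^+=\mathbf U_{j+1/2}^+$; at the two domain endpoints the missing trace is a prescribed exterior boundary trace. Put $\alpha_j=\max\{\alpha_\star(\mathbf U_{j,R},\mathbf U_{j,L};\mathbf e_1),\alpha_\star(\mathbf U_{j,L},\mathbf U_{j,R};\mathbf e_1)\}$. **Numerical fluxes and budget.** At each interface with wave speeds $a^-<0<a^+$ (shared by both adjacent cells and independent of $\lambda$): $\widehat{\mathbf F}_1=\frac{a^+\mathbf F_1(\mathbf U^-)-a^-\mathbf F_1(\mathbf U^+)+a^+a^-(\mathbf U^+-\mathbf U^-)}{a^+-a^-}$, $\widehat q_r=\frac{a^+q_r(\mathbf U^-)-a^-q_r(\mathbf U^+)+a^+a^-(\eta_r(\mathbf U^+)-\eta_r(\mathbf U^-))}{a^+-a^-}$;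 a subscript $j+1/2$ denotes evaluation at $x_{j+1/2}$. $\lambda$ is the time step divided by $\Delta x$, and $\mathcal B_{j,r}^n=\sum_{\alpha=1}^L\widehat\omega_\alpha\eta_r(\widehat{\mathbf U}_j^{[\alpha]})-\lambda(\widehat q_{j+1/2,r}-\widehat q_{j-1/2,r})$. **Relative-entropy quantities.** $\mathbf V_r=\nabla\eta_r$ (gradient in all eight variables), $\psi_r(\mathbf U)=\mathbf V_r(\mathbf U)^\top\mathbf F_1(\mathbf U)-q_r(\mathbf U)$, $\mathcal H_r(\mathbf U\mid\mathbf W)=\eta_r(\mathbf U)-\eta_r(\mathbf W)-\mathbf V_r(\mathbf W)^\top(\mathbf U-\mathbf W)$. Boundary defects: $P_{j,L,r}(\mathbf W)=-\psi_r(\mathbf W)+\mathbf V_r(\mathbf W)^\top\widehat{\mathbf F}_{1,j-1/2}-\widehat q_{j-1/2,r}$, $P_{j,R,r}(\mathbf W)=\psi_r(\mathbf W)-\mathbf V_r(\mathbf W)^\top\widehat{\mathbf F}_{1,j+1/2}+\widehat q_{j+1/2,r}$. One-sided dissipations at an interface: $d_r^-=\mathbf V_r(\mathbf U^-)^\top\widehat{\mathbf F}_1-\widehat q_r-\psi_r(\mathbf U^-)$, $d_r^+=\psi_r(\mathbf U^+)-\mathbf V_r(\mathbf U^+)^\top\widehat{\mathbf F}_1+\widehat q_r$. **Reference step, path, rates.** Fix $\sigma\in(0,1)$; $\lambda_j^0=\frac{\sigma\widehat\omega_1}{\max\{\alpha_j+a_{j-1/2}^+,\ \alpha_j-a_{j+1/2}^-\}}>0$;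 $\mathscr W_j=\{\overline{\mathbf U}_j^n-\vartheta(\widehat{\mathbf F}_{1,j+1/2}-\widehat{\mathbf F}_{1,j-1/2}):0\le\vartheta\le\lambda_j^0\}\subset\mathcal G_{B_{\rm const}}$; for $\nu\in\{L,R\}$, $\mathfrak c_{j,\nu,r}=\sup_{\mathbf W\in\mathscr W_j,\ \mathbf W\neq\mathbf U_{j,\nu}}\frac{[P_{j,\nu,r}(\mathbf W)]_+}{\mathcal H_r(\mathbf U_{j,\nu}\mid\mathbf W)}$ (empty supremum $=0$), $\mathfrak c_{j,\nu}=\max_{1\le r\le M}\mathfrak c_{j,\nu,r}$. *)

theory Defs
  imports "HOL-Analysis.Analysis" "HOL-Computational_Algebra.Polynomial"
begin

section \<open>Ideal MHD states, flux and entropy pairs\<close>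

text \<open>A state \<open>(\<rho>, m, B, E)\<close>. The inner product of this product type is the
  Euclidean inner product of \<open>\<real>\<^sup>8\<close>.\<close>

type_synonym state = "real \<times> (real^3) \<times> (real^3) \<times> real"

definition dens :: "state \<Rightarrow> real" where "dens U = fst U"
definition mom :: "state \<Rightarrow> real^3" where "mom U = fst (snd U)"
definition mag :: "state \<Rightarrow> real^3" where "mag U = fst (snd (snd U))"
definition energy :: "state \<Rightarrow> real" where "energy U = snd (snd (snd U))"

definition e1 :: "real^3" where "e1 = axis 1 1"

definition vel :: "state \<Rightarrow> real^3" where
  "vel U = mom U /\<^sub>R dens U"

definition internal_energy :: "state \<Rightarrow> real" where
  "internal_energy U = energy U - (norm (mom U))\<^sup>2 / (2 * dens U) - (norm (mag U))\<^sup>2 / 2"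

definition pressure :: "real \<Rightarrow> state \<Rightarrow> real" where
  "pressure \<gamma> U = (\<gamma> - 1) * internal_energy U"

definition total_pressure :: "real \<Rightarrow> state \<Rightarrow> real" where
  "total_pressure \<gamma> U = pressure \<gamma> U + (norm (mag U))\<^sup>2 / 2"

definition admissible :: "state set" where
  "admissible = {U. dens U > 0 \<and> internal_energy U > 0}"

definition admissible_B :: "real \<Rightarrow> state set" where
  "admissible_B Bc = {U \<in> admissible. mag U $ 1 = Bc}"

definition flux1 :: "real \<Rightarrow> state \<Rightarrow> state" where
  "flux1 \<gamma> U =
    (dens U * vel U $ 1,
     (vel U $ 1) *\<^sub>R mom U - (mag U $ 1) *\<^sub>R mag U + total_pressure \<gamma> U *\<^sub>R e1,
     (vel U $ 1) *\<^sub>R mag U - (mag U $ 1) *\<^sub>R vel U,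
     (vel U $ 1) * (energy U + total_pressure \<gamma> U) - (mag U $ 1) * (vel U \<bullet> mag U))"

definition spec_entropy :: "real \<Rightarrow> state \<Rightarrow> real" where
  "spec_entropy \<gamma> U = ln (pressure \<gamma> U) - \<gamma> * ln (dens U)"

definition eta :: "real \<Rightarrow> (real \<Rightarrow> real) \<Rightarrow> state \<Rightarrow> real" where
  "eta \<gamma> f U = - dens U * f (spec_entropy \<gamma> U)"

definition entropy_flux :: "real \<Rightarrow> (real \<Rightarrow> real) \<Rightarrow> state \<Rightarrow> real" where
  "entropy_flux \<gamma> f U = (vel U $ 1) * eta \<gamma> f U"

definition C2_real :: "(real \<Rightarrow> real) \<Rightarrow> bool" where
  "C2_real f \<longleftrightarrow>
    f differentiable_on UNIV \<and> deriv f differentiable_on UNIV \<and>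
    continuous_on UNIV (deriv (deriv f))"

definition gradient :: "('a::real_inner \<Rightarrow> real) \<Rightarrow> 'a \<Rightarrow> 'a" where
  "gradient g x = (THE D. GDERIV g x :> D)"

definition entropy_var :: "real \<Rightarrow> (real \<Rightarrow> real) \<Rightarrow> state \<Rightarrow> state" where
  "entropy_var \<gamma> f = gradient (eta \<gamma> f)"

definition entropy_pot :: "real \<Rightarrow> (real \<Rightarrow> real) \<Rightarrow> state \<Rightarrow> real" where
  "entropy_pot \<gamma> f U = entropy_var \<gamma> f U \<bullet> flux1 \<gamma> U - entropy_flux \<gamma> f U"

definition rel_entropy :: "real \<Rightarrow> (real \<Rightarrow> real) \<Rightarrow> state \<Rightarrow> state \<Rightarrow> real" where
  "rel_entropy \<gamma> f U W = eta \<gamma> f U - eta \<gamma> f W - entropy_var \<gamma> f W \<bullet> (U - W)"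


section \<open>Splitting speeds\<close>

definition Cs_sq :: "real \<Rightarrow> state \<Rightarrow> real" where
  "Cs_sq \<gamma> U = (\<gamma> - 1) * pressure \<gamma> U / (2 * dens U)"

definition Cspeed :: "real \<Rightarrow> state \<Rightarrow> real^3 \<Rightarrow> real" where
  "Cspeed \<gamma> U \<xi> =
    (let a = Cs_sq \<gamma> U + (norm (mag U))\<^sup>2 / dens U in
     1 / sqrt 2 * sqrt (a + sqrt (a\<^sup>2 - 4 * (Cs_sq \<gamma> U * (\<xi> \<bullet> mag U)\<^sup>2 / dens U))))"

definition roe_vel :: "state \<Rightarrow> state \<Rightarrow> real^3" where
  "roe_vel U U' =
    (sqrt (dens U) *\<^sub>R vel U + sqrt (dens U') *\<^sub>R vel U') /\<^sub>R (sqrt (dens U) + sqrt (dens U'))"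

definition mag_jump :: "state \<Rightarrow> state \<Rightarrow> real" where
  "mag_jump U U' = norm (mag U - mag U') / (sqrt (dens U) + sqrt (dens U'))"

definition alpha_r :: "real \<Rightarrow> state \<Rightarrow> state \<Rightarrow> real^3 \<Rightarrow> real" where
  "alpha_r \<gamma> U U' \<xi> = max (vel U \<bullet> \<xi>) (roe_vel U U' \<bullet> \<xi>) + Cspeed \<gamma> U \<xi> + mag_jump U U'"

definition alpha_l :: "real \<Rightarrow> state \<Rightarrow> state \<Rightarrow> real^3 \<Rightarrow> real" where
  "alpha_l \<gamma> U U' \<xi> = min (vel U \<bullet> \<xi>) (roe_vel U U' \<bullet> \<xi>) - Cspeed \<gamma> U \<xi> - mag_jump U U'"

definition alpha_star :: "real \<Rightarrow> state \<Rightarrow> state \<Rightarrow> real^3 \<Rightarrow> real" where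
  "alpha_star \<gamma> U U' \<xi> =
    max \<bar>vel U \<bullet> \<xi>\<bar> \<bar>roe_vel U U' \<bullet> \<xi>\<bar> + Cspeed \<gamma> U \<xi> + mag_jump U U'"


section \<open>Gauss--Lobatto quadrature, mesh and numerical data\<close>

text \<open>The \<open>L\<close>-point rule on the reference interval \<open>[-1, 1]\<close>, with weights normalised to sum
  to one, so that it approximates the mean value. It is characterised by containing both
  endpoints and being exact up to degree \<open>2 L - 3\<close>; the three conditions on the weights are
  consequences of this and only record well-known properties of the rule.\<close>

definition gauss_lobatto :: "nat \<Rightarrow> (nat \<Rightarrow> real) \<Rightarrow> (nat \<Rightarrow> real) \<Rightarrow> bool" where
  "gauss_lobatto L x w \<longleftrightarrow>
    L \<ge> 2 \<and> strict_mono_on {1..L} x \<and> x 1 = -1 \<and> x L = 1 \<and>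
    (\<forall>p::real poly. degree p \<le> 2 * L - 3 \<longrightarrow>
       (\<Sum>i=1..L. w i * poly p (x i)) = 1 / 2 * integral {-1..1} (poly p)) \<and>
    (\<forall>i\<in>{1..L}. w i > 0) \<and> (\<Sum>i=1..L. w i) = 1 \<and>
    w 1 = 1 / (real L * (real L - 1)) \<and> w L = 1 / (real L * (real L - 1))"

text \<open>Cells are numbered \<open>1, \<dots>, ncells\<close>. The interface index \<open>i \<in> {0, \<dots>, ncells}\<close>
  stands for the point \<open>x\<close> with half-integer subscript \<open>i + 1/2\<close>, so that cell \<open>j\<close> lies
  between the interfaces \<open>j - 1\<close> and \<open>j\<close>. \<open>sol j\<close> is the piece of the numerical solution
  on cell \<open>j\<close>, \<open>ext_left\<close> and \<open>ext_right\<close> are the exterior boundary traces, and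
  \<open>aminus\<close>, \<open>aplus\<close> are the wave speeds at the interfaces.\<close>

record scheme =
  ncells :: nat
  xleft :: real
  dx :: real
  nnodes :: nat
  node :: "nat \<Rightarrow> real"
  weight :: "nat \<Rightarrow> real"
  sol :: "nat \<Rightarrow> real \<Rightarrow> state"
  ext_left :: state
  ext_right :: state
  aminus :: "nat \<Rightarrow> real"
  aplus :: "nat \<Rightarrow> real"

definition face :: "scheme \<Rightarrow> nat \<Rightarrow> real" where
  "face S i = xleft S + real i * dx S"

definition cell :: "scheme \<Rightarrow> nat \<Rightarrow> real set" where
  "cell S j = {face S (j - 1)..face S j}"

text \<open>Every one of the eight components is a polynomial of degree at most \<open>k\<close> on \<open>I\<close>.\<close>

definition poly_on :: "nat \<Rightarrow> real set \<Rightarrow> (real \<Rightarrow> state) \<Rightarrow> bool" where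
  "poly_on k I u \<longleftrightarrow>
    (\<forall>b\<in>Basis. \<exists>p::real poly. degree p \<le> k \<and> (\<forall>x\<in>I. u x \<bullet> b = poly p x))"

definition quad_point :: "scheme \<Rightarrow> nat \<Rightarrow> nat \<Rightarrow> real" where
  "quad_point S j i = face S (j - 1) + dx S / 2 * (1 + node S i)"

definition quad_state :: "scheme \<Rightarrow> nat \<Rightarrow> nat \<Rightarrow> state" where
  "quad_state S j i = sol S j (quad_point S j i)"

definition cell_avg :: "scheme \<Rightarrow> nat \<Rightarrow> state" where
  "cell_avg S j = integral (cell S j) (sol S j) /\<^sub>R dx S"

definition state_L :: "scheme \<Rightarrow> nat \<Rightarrow> state" where
  "state_L S j = quad_state S j 1"

definition state_R :: "scheme \<Rightarrow> nat \<Rightarrow> state" where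
  "state_R S j = quad_state S j (nnodes S)"

definition trace_minus :: "scheme \<Rightarrow> nat \<Rightarrow> state" where
  "trace_minus S i = (if i = 0 then ext_left S else state_R S i)"

definition trace_plus :: "scheme \<Rightarrow> nat \<Rightarrow> state" where
  "trace_plus S i = (if i = ncells S then ext_right S else state_L S (i + 1))"

definition alpha_cell :: "real \<Rightarrow> scheme \<Rightarrow> nat \<Rightarrow> real" where
  "alpha_cell \<gamma> S j =
    max (alpha_star \<gamma> (state_R S j) (state_L S j) e1)
        (alpha_star \<gamma> (state_L S j) (state_R S j) e1)"


section \<open>Numerical fluxes, update and entropy budget\<close>

definition num_flux :: "real \<Rightarrow> scheme \<Rightarrow> nat \<Rightarrow> state" where
  "num_flux \<gamma> S i =
    (let am = aminus S i; ap = aplus S i; Um = trace_minus S i; Up = trace_plus S i in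
     (ap *\<^sub>R flux1 \<gamma> Um - am *\<^sub>R flux1 \<gamma> Up + (ap * am) *\<^sub>R (Up - Um)) /\<^sub>R (ap - am))"

definition num_entropy_flux :: "real \<Rightarrow> (real \<Rightarrow> real) \<Rightarrow> scheme \<Rightarrow> nat \<Rightarrow> real" where
  "num_entropy_flux \<gamma> f S i =
    (let am = aminus S i; ap = aplus S i; Um = trace_minus S i; Up = trace_plus S i in
     (ap * entropy_flux \<gamma> f Um - am * entropy_flux \<gamma> f Up + ap * am * (eta \<gamma> f Up - eta \<gamma> f Um))
       / (ap - am))"

definition update :: "real \<Rightarrow> scheme \<Rightarrow> real \<Rightarrow> nat \<Rightarrow> state" where
  "update \<gamma> S lam j = cell_avg S j - lam *\<^sub>R (num_flux \<gamma> S j - num_flux \<gamma> S (j - 1))"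

definition budget :: "real \<Rightarrow> (real \<Rightarrow> real) \<Rightarrow> scheme \<Rightarrow> real \<Rightarrow> nat \<Rightarrow> real" where
  "budget \<gamma> f S lam j =
    (\<Sum>i=1..nnodes S. weight S i * eta \<gamma> f (quad_state S j i))
      - lam * (num_entropy_flux \<gamma> f S j - num_entropy_flux \<gamma> f S (j - 1))"


section \<open>Dissipations, boundary defects and the step-size bound\<close>

definition diss_minus :: "real \<Rightarrow> (real \<Rightarrow> real) \<Rightarrow> scheme \<Rightarrow> nat \<Rightarrow> real" where
  "diss_minus \<gamma> f S i =
    entropy_var \<gamma> f (trace_minus S i) \<bullet> num_flux \<gamma> S i - num_entropy_flux \<gamma> f S i
      - entropy_pot \<gamma> f (trace_minus S i)"

definition diss_plus :: "real \<Rightarrow> (real \<Rightarrow> real) \<Rightarrow> scheme \<Rightarrow> nat \<Rightarrow> real" where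
  "diss_plus \<gamma> f S i =
    entropy_pot \<gamma> f (trace_plus S i) - entropy_var \<gamma> f (trace_plus S i) \<bullet> num_flux \<gamma> S i
      + num_entropy_flux \<gamma> f S i"

definition defect_L :: "real \<Rightarrow> (real \<Rightarrow> real) \<Rightarrow> scheme \<Rightarrow> nat \<Rightarrow> state \<Rightarrow> real" where
  "defect_L \<gamma> f S j W =
    - entropy_pot \<gamma> f W + entropy_var \<gamma> f W \<bullet> num_flux \<gamma> S (j - 1)
      - num_entropy_flux \<gamma> f S (j - 1)"

definition defect_R :: "real \<Rightarrow> (real \<Rightarrow> real) \<Rightarrow> scheme \<Rightarrow> nat \<Rightarrow> state \<Rightarrow> real" where
  "defect_R \<gamma> f S j W =
    entropy_pot \<gamma> f W - entropy_var \<gamma> f W \<bullet> num_flux \<gamma> S j + num_entropy_flux \<gamma> f S j"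

definition lambda0 :: "real \<Rightarrow> real \<Rightarrow> scheme \<Rightarrow> nat \<Rightarrow> real" where
  "lambda0 \<gamma> \<sigma> S j =
    \<sigma> * weight S 1 /
      max (alpha_cell \<gamma> S j + aplus S (j - 1)) (alpha_cell \<gamma> S j - aminus S j)"

definition update_path :: "real \<Rightarrow> real \<Rightarrow> scheme \<Rightarrow> nat \<Rightarrow> state set" where
  "update_path \<gamma> \<sigma> S j = (\<lambda>\<theta>. update \<gamma> S \<theta> j) ` {0..lambda0 \<gamma> \<sigma> S j}"

text \<open>The rates are extended nonnegative reals, because the suprema are not known a priori to be
  finite. In \<open>ennreal\<close> the empty supremum is \<open>0\<close> and \<open>a / 0 = \<infinity>\<close> for \<open>a > 0\<close>.\<close>

definition rate_L :: "real \<Rightarrow> real \<Rightarrow> (real \<Rightarrow> real) \<Rightarrow> scheme \<Rightarrow> nat \<Rightarrow> ennreal" where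
  "rate_L \<gamma> \<sigma> f S j =
    (SUP W\<in>update_path \<gamma> \<sigma> S j - {state_L S j}.
       ennreal (max (defect_L \<gamma> f S j W) 0) / ennreal (rel_entropy \<gamma> f (state_L S j) W))"

definition rate_R :: "real \<Rightarrow> real \<Rightarrow> (real \<Rightarrow> real) \<Rightarrow> scheme \<Rightarrow> nat \<Rightarrow> ennreal" where
  "rate_R \<gamma> \<sigma> f S j =
    (SUP W\<in>update_path \<gamma> \<sigma> S j - {state_R S j}.
       ennreal (max (defect_R \<gamma> f S j W) 0) / ennreal (rel_entropy \<gamma> f (state_R S j) W))"

definition max_rate_L ::
  "real \<Rightarrow> real \<Rightarrow> (nat \<Rightarrow> real \<Rightarrow> real) \<Rightarrow> nat \<Rightarrow> scheme \<Rightarrow> nat \<Rightarrow> ennreal" where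
  "max_rate_L \<gamma> \<sigma> f M S j = (MAX r\<in>{1..M}. rate_L \<gamma> \<sigma> (f r) S j)"

definition max_rate_R ::
  "real \<Rightarrow> real \<Rightarrow> (nat \<Rightarrow> real \<Rightarrow> real) \<Rightarrow> nat \<Rightarrow> scheme \<Rightarrow> nat \<Rightarrow> ennreal" where
  "max_rate_R \<gamma> \<sigma> f M S j = (MAX r\<in>{1..M}. rate_R \<gamma> \<sigma> (f r) S j)"

definition lambda_rel ::
  "real \<Rightarrow> real \<Rightarrow> (nat \<Rightarrow> real \<Rightarrow> real) \<Rightarrow> nat \<Rightarrow> scheme \<Rightarrow> ennreal" where
  "lambda_rel \<gamma> \<sigma> f M S =
    (MIN j\<in>{1..ncells S}.
       Min {ennreal (lambda0 \<gamma> \<sigma> S j),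
            ennreal (weight S 1) / max_rate_L \<gamma> \<sigma> f M S j,
            ennreal (weight S 1) / max_rate_R \<gamma> \<sigma> f M S j})"

end

theory Submission
  imports Defs
begin

text \<open>With \<open>W\<close> the updated average, exactness of the quadrature gives the identity
  \<open>\<eta>(W) - budget = \<lambda> (P\<^sub>L(W) + P\<^sub>R(W)) - \<Sum> \<omega>\<^sub>\<alpha> H(U\<^sub>\<alpha> | W)\<close>. The relative entropies are nonnegative by
  convexity, and the definition of the rates bounds \<open>\<lambda> P\<^sub>\<nu>(W)\<close> by \<open>\<omega>\<^sub>1 H(U\<^sub>\<nu> | W)\<close>; if \<open>W = U\<^sub>\<nu>\<close>, then
  \<open>P\<^sub>\<nu>(W)\<close> is minus a one-sided dissipation. It remains to show that \<open>W\<close> is admissible. Admissibility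
  is a family of affine inequalities in the state, and these are preserved because \<open>W\<close> splits into
  quadrature states, the intermediate states of the two HLL fluxes and Lax--Friedrichs pairs
  \<open>(a U - F(U)) + (F(V) - a' V)\<close>.\<close>

section \<open>Linear test functionals for admissibility\<close>

lemma dens_simps [simp]: "dens (U + V) = dens U + dens V" "dens (U - V) = dens U - dens V"
  "dens (c *\<^sub>R U) = c * dens U"
  and mag_simps [simp]: "mag (U + V) = mag U + mag V" "mag (U - V) = mag U - mag V"
  "mag (c *\<^sub>R U) = c *\<^sub>R mag U"
  by (auto simp: dens_def mag_def)

lemma mag_sum: "mag (sum g A) = (\<Sum>i\<in>A. mag (g i))"
  by (induction A rule: infinite_finite_induct) (auto simp: mag_def)

lemma inner_e1 [simp]: "x \<bullet> e1 = x $ 1" "e1 \<bullet> x = x $ 1"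
  by (simp_all add: e1_def inner_axis inner_axis' )

lemma mom_eq_vel: "dens U > 0 \<Longrightarrow> mom U = dens U *\<^sub>R vel U"
  by (simp add: vel_def)

lemma admissibleD:
  assumes "U \<in> admissible"
  shows "dens U > 0" "internal_energy U > 0"
  using assms by (auto simp: admissible_def)

text \<open>The geometric quasilinearization of Wu and Shu: the nonlinear constraint
  \<open>internal_energy U > 0\<close> is the intersection over all \<open>v\<close>, \<open>b\<close> of the constraints
  \<open>U \<bullet> gql v b + |b|\<^sup>2 / 2 > 0\<close>, which are affine in \<open>U\<close>.\<close>

definition gql :: "real^3 \<Rightarrow> real^3 \<Rightarrow> state" where
  "gql v b = ((norm v)\<^sup>2 / 2, - v, - b, 1)"

lemma inner_gql: "U \<bullet> gql v b = dens U * (v \<bullet> v) / 2 - mom U \<bullet> v - mag U \<bullet> b + energy U"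
  by (cases U) (simp add: gql_def dens_def mom_def mag_def energy_def power2_norm_eq_inner)

text \<open>The value of the affine test at positive density, written as a sum of terms that are
  nonnegative on \<open>admissible\<close>.\<close>

definition gql_energy :: "real^3 \<Rightarrow> real^3 \<Rightarrow> state \<Rightarrow> real" where
  "gql_energy v b U = internal_energy U + dens U * (norm (vel U - v))\<^sup>2 / 2
     + (norm (mag U - b))\<^sup>2 / 2"

lemma energy_eq:
  assumes "dens U > 0"
  shows "energy U = internal_energy U + dens U * (vel U \<bullet> vel U) / 2 + mag U \<bullet> mag U / 2"
  using assms by (simp add: internal_energy_def mom_eq_vel power2_norm_eq_inner power_mult_distrib)
    (simp add: field_simps power2_eq_square)

lemma gql_affine:
  assumes "dens U > 0"
  shows "U \<bullet> gql v b + (norm b)\<^sup>2 / 2 = gql_energy v b U"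
  using assms
  by (simp add: inner_gql gql_energy_def mom_eq_vel power2_norm_eq_inner energy_eq
      inner_diff_left inner_diff_right inner_commute algebra_simps) (simp add: field_simps)

text \<open>At the state's own velocity and field both squares in \<open>gql_energy\<close> vanish,
  so the tests recover the nonlinear constraint.\<close>

lemma internal_energy_eq_gql:
  assumes "dens U > 0"
  shows "internal_energy U = U \<bullet> gql (vel U) (mag U) + (norm (mag U))\<^sup>2 / 2"
  unfolding gql_affine[OF assms] by (simp add: gql_energy_def)

lemma gql_energy_pos:
  assumes "U \<in> admissible"
  shows "gql_energy v b U > 0"
  using admissibleD[OF assms] unfolding gql_energy_def
  by (intro add_pos_nonneg) auto

text \<open>The last bracket depends on \<open>U\<close> only through \<open>B\<^sub>1\<close>, so it cancels between two states with
  the same \<open>B\<^sub>1\<close>. The middle one is controlled by \<open>Cspeed\<close>.\<close>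

lemma flux1_inner_gql:
  assumes "dens U > 0"
  shows "flux1 \<gamma> U \<bullet> gql v b =
    vel U $ 1 * gql_energy v b U
    + (pressure \<gamma> U * (vel U - v) $ 1 + (vel U - v) $ 1 * ((mag U - b) \<bullet> mag U)
        - mag U $ 1 * ((vel U - v) \<bullet> (mag U - b)))
    - (vel U - v) $ 1 * (norm (mag U - b))\<^sup>2 / 2
    + (mag U $ 1 * (v \<bullet> b) - v $ 1 * (norm b)\<^sup>2 / 2)"
proof -
  define r u B e p where "r = dens U" and "u = vel U" and "B = mag U" and "e = internal_energy U"
    and "p = pressure \<gamma> U"
  have "mom U = r *\<^sub>R u" "energy U = e + r * (u \<bullet> u) / 2 + B \<bullet> B / 2"
    using assms mom_eq_vel energy_eq by (auto simp: r_def u_def B_def e_def)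
  then show ?thesis
    unfolding flux1_def gql_def gql_energy_def total_pressure_def
    unfolding r_def[symmetric] u_def[symmetric] B_def[symmetric] e_def[symmetric] p_def[symmetric]
    by (simp add: power2_norm_eq_inner inner_diff_left inner_diff_right inner_add_left
        inner_commute[of v u] inner_commute[of b u] inner_commute[of B u] inner_commute[of b v]
        inner_commute[of b B] inner_commute[of v B])
      (simp add: algebra_simps add_divide_distrib diff_divide_distrib)
qed

section \<open>The speed \<open>Cspeed\<close> as an eigenvalue bound\<close>

lemma quadratic_form_nonneg:
  fixes P R q x y :: real
  assumes "P \<ge> 0" "R \<ge> 0" "q\<^sup>2 \<le> P * R"
  shows "P * x\<^sup>2 + 2 * q * x * y + R * y\<^sup>2 \<ge> 0"
proof -
  have "\<bar>q\<bar> \<le> sqrt P * sqrt R"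
    using assms(3) by (metis real_le_rsqrt real_sqrt_mult power2_abs)
  then have "\<bar>q * x * y\<bar> \<le> (sqrt P * \<bar>x\<bar>) * (sqrt R * \<bar>y\<bar>)"
    by (simp add: abs_mult mult_right_mono mult.assoc mult.left_commute[of "\<bar>x\<bar>"])
      (metis abs_ge_zero mult.assoc mult_right_mono zero_le_mult_iff)
  also have "2 * \<dots> \<le> (sqrt P * \<bar>x\<bar>)\<^sup>2 + (sqrt R * \<bar>y\<bar>)\<^sup>2"
    using sum_squares_bound[of "sqrt P * \<bar>x\<bar>" "sqrt R * \<bar>y\<bar>"] by simp
  also have "\<dots> = P * x\<^sup>2 + R * y\<^sup>2"
    using assms by (simp add: power_mult_distrib)
  finally show ?thesis by simp
qed

text \<open>The square of \<open>Cspeed\<close> is the larger root of \<open>(z - c - h2) (z - h1) = h1 h2\<close>, i.e. the larger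
  eigenvalue of the form bounded in \<open>Cspeed_quadratic_form\<close>.\<close>

lemma Cspeed_props:
  fixes U :: state and \<gamma> :: real
  assumes "U \<in> admissible" "\<gamma> > 1"
  defines "c \<equiv> Cs_sq \<gamma> U" and "h1 \<equiv> (mag U $ 1)\<^sup>2 / dens U"
    and "h2 \<equiv> ((mag U $ 2)\<^sup>2 + (mag U $ 3)\<^sup>2) / dens U"
  shows "Cspeed \<gamma> U e1 > 0"
    "((Cspeed \<gamma> U e1)\<^sup>2 - c - h2) * ((Cspeed \<gamma> U e1)\<^sup>2 - h1) = h1 * h2"
    "(Cspeed \<gamma> U e1)\<^sup>2 - c - h2 \<ge> 0" "(Cspeed \<gamma> U e1)\<^sup>2 - h1 \<ge> 0"
proof -
  note adm = admissibleD[OF assms(1)]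
  have c: "c > 0" using adm assms(2) by (simp add: c_def Cs_sq_def pressure_def)
  have h: "h1 \<ge> 0" "h2 \<ge> 0" using adm by (simp_all add: h1_def h2_def)
  define a where "a = c + h1 + h2"
  define d where "d = a\<^sup>2 - 4 * (c * h1)"
  have a: "Cs_sq \<gamma> U + (norm (mag U))\<^sup>2 / dens U = a"
    unfolding power2_norm_eq_inner
    by (simp add: a_def c_def h1_def h2_def inner_vec_def sum_3 power2_eq_square
        add_divide_distrib)
  have C: "Cspeed \<gamma> U e1 = 1 / sqrt 2 * sqrt (a + sqrt d)"
    by (simp add: Cspeed_def Let_def a d_def c_def h1_def)
  \<comment> \<open>Written as a sum of nonnegative terms, the discriminant shows that the roots are
    real.\<close>
  have "d = (c - h1)\<^sup>2 + h2\<^sup>2 + 2 * h2 * (c + h1)"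
    by (simp add: d_def a_def power2_eq_square algebra_simps)
  then have d: "d \<ge> 0" using c h by simp
  have apos: "a > 0" using c h by (simp add: a_def)
  then have "a + sqrt d > 0" using d by (simp add: add_pos_nonneg)
  then show "Cspeed \<gamma> U e1 > 0" by (simp add: C)
  have C2: "(Cspeed \<gamma> U e1)\<^sup>2 = (a + sqrt d) / 2"
    using \<open>a + sqrt d > 0\<close> by (simp add: C power_mult_distrib power_divide)
  have "(sqrt d)\<^sup>2 = d" using d by simp
  then show prod: "((Cspeed \<gamma> U e1)\<^sup>2 - c - h2) * ((Cspeed \<gamma> U e1)\<^sup>2 - h1) = h1 * h2"
    unfolding C2 d_def a_def by (simp add: field_simps power2_eq_square)
  \<comment> \<open>The two factors have nonnegative sum \<open>sqrt d\<close> and nonnegative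
    product, so neither is negative.\<close>
  have "((Cspeed \<gamma> U e1)\<^sup>2 - c - h2) + ((Cspeed \<gamma> U e1)\<^sup>2 - h1) \<ge> 0"
    using d unfolding C2 a_def by simp
  moreover have "((Cspeed \<gamma> U e1)\<^sup>2 - c - h2) * ((Cspeed \<gamma> U e1)\<^sup>2 - h1) \<ge> 0"
    unfolding prod using h by simp
  ultimately show "(Cspeed \<gamma> U e1)\<^sup>2 - c - h2 \<ge> 0" "(Cspeed \<gamma> U e1)\<^sup>2 - h1 \<ge> 0"
    by (auto simp: zero_le_mult_iff)
qed

text \<open>The difference of the two sides is
  \<open>P u1^2 + 2 h1 u1 (h2 u2 + h3 u3) + R (u2^2 + u3^2)\<close>. Cauchy-Schwarz in the
  transverse components reduces it to two variables, where \<open>P * R = h1^2 (h2^2 + h3^2)\<close>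
  from \<open>Cspeed_props\<close> makes the form semidefinite.\<close>

lemma Cspeed_quadratic_form:
  fixes U :: state and u1 u2 u3 :: real
  assumes "U \<in> admissible" "\<gamma> > 1"
  defines "s \<equiv> sqrt (dens U)"
  shows "Cs_sq \<gamma> U * u1\<^sup>2 + ((mag U $ 2 / s) * u1 - (mag U $ 1 / s) * u2)\<^sup>2
      + ((mag U $ 3 / s) * u1 - (mag U $ 1 / s) * u3)\<^sup>2
    \<le> (Cspeed \<gamma> U e1)\<^sup>2 * (u1\<^sup>2 + u2\<^sup>2 + u3\<^sup>2)"
proof -
  define h1 h2 h3 where "h1 = mag U $ 1 / s" and "h2 = mag U $ 2 / s" and "h3 = mag U $ 3 / s"
  have s: "s\<^sup>2 = dens U" using admissibleD[OF assms(1)] by (simp add: s_def)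
  define P R where "P = (Cspeed \<gamma> U e1)\<^sup>2 - Cs_sq \<gamma> U - (h2\<^sup>2 + h3\<^sup>2)"
    and "R = (Cspeed \<gamma> U e1)\<^sup>2 - h1\<^sup>2"
  have hh: "h1\<^sup>2 = (mag U $ 1)\<^sup>2 / dens U"
    "h2\<^sup>2 + h3\<^sup>2 = ((mag U $ 2)\<^sup>2 + (mag U $ 3)\<^sup>2) / dens U"
    by (simp_all add: h1_def h2_def h3_def power_divide s add_divide_distrib)
  note C = Cspeed_props[OF assms(1,2), folded hh, folded P_def R_def]
  have pos: "P * u1\<^sup>2 + 2 * (h1 * sqrt (h2\<^sup>2 + h3\<^sup>2)) * \<bar>u1\<bar> * t + R * t\<^sup>2 \<ge> 0" for t
    using quadratic_form_nonneg[of P R "h1 * sqrt (h2\<^sup>2 + h3\<^sup>2)" "\<bar>u1\<bar>" t] C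
    by (simp add: power_mult_distrib)
  define n where "n = sqrt (u2\<^sup>2 + u3\<^sup>2)"
  have "\<bar>h2 * u2 + h3 * u3\<bar> \<le> sqrt (h2\<^sup>2 + h3\<^sup>2) * n"
  proof -
    have "(h2\<^sup>2 + h3\<^sup>2) * (u2\<^sup>2 + u3\<^sup>2) - (h2 * u2 + h3 * u3)\<^sup>2 = (h2 * u3 - h3 * u2)\<^sup>2"
      by (simp add: power2_eq_square algebra_simps)
    then have "(h2 * u2 + h3 * u3)\<^sup>2 \<le> (h2\<^sup>2 + h3\<^sup>2) * (u2\<^sup>2 + u3\<^sup>2)"
      by (metis diff_ge_0_iff_ge zero_le_power2)
    then show ?thesis unfolding n_def by (metis real_le_rsqrt real_sqrt_mult power2_abs)
  qed
  then have "\<bar>h1\<bar> * \<bar>u1\<bar> * \<bar>h2 * u2 + h3 * u3\<bar> \<le> \<bar>h1\<bar> * \<bar>u1\<bar> * (sqrt (h2\<^sup>2 + h3\<^sup>2) * n)"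
    by (intro mult_left_mono) auto
  then have "\<bar>h1 * u1 * (h2 * u2 + h3 * u3)\<bar> \<le> \<bar>h1\<bar> * \<bar>u1\<bar> * (sqrt (h2\<^sup>2 + h3\<^sup>2) * n)"
    by (simp add: abs_mult)
  \<comment> \<open>Both signs of \<open>n\<close> are used so that the mixed term carries
    \<open>\<bar>h1\<bar>\<close> whatever the sign of \<open>h1\<close>.\<close>
  moreover have "P * u1\<^sup>2 - 2 * (\<bar>h1\<bar> * \<bar>u1\<bar> * (sqrt (h2\<^sup>2 + h3\<^sup>2) * n)) + R * n\<^sup>2 \<ge> 0"
    using pos[of n] pos[of "- n"] by (cases "h1 \<ge> 0") (auto simp: mult_ac)
  ultimately have "P * u1\<^sup>2 + 2 * (h1 * u1 * (h2 * u2 + h3 * u3)) + R * (u2\<^sup>2 + u3\<^sup>2) \<ge> 0"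
    by (simp add: n_def)
  then show ?thesis
    unfolding h1_def[symmetric] h2_def[symmetric] h3_def[symmetric] P_def R_def
    by (simp add: power2_eq_square algebra_simps)
qed

section \<open>The generalized Lax--Friedrichs splitting\<close>

lemma scaled_AM_GM:
  fixes C x X :: real
  shows "2 * C * \<bar>x * X\<bar> \<le> C\<^sup>2 * x\<^sup>2 + X\<^sup>2"
proof -
  have "2 * (C * \<bar>x\<bar>) * \<bar>X\<bar> \<le> (C * \<bar>x\<bar>)\<^sup>2 + \<bar>X\<bar>\<^sup>2"
    by (rule sum_squares_bound)
  then show ?thesis by (simp add: power_mult_distrib abs_mult mult_ac)
qed

text \<open>With \<open>w = vel U - v\<close> and \<open>mag U - b\<close> in place of
  \<open>b\<close>, the left side is the middle bracket of \<open>flux1_inner_gql\<close>. In scaled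
  variables it is twice an inner product of \<open>(x, y)\<close> with \<open>(X, Y)\<close>.
  Weighted AM-GM leaves the squares of \<open>X\<close> and \<open>Y\<close>, which
  \<open>Cspeed_quadratic_form\<close> bounds by the kinetic part.\<close>

lemma cross_term_bound:
  fixes U :: state and w b :: "real^3"
  assumes "U \<in> admissible" "\<gamma> > 1"
  shows "\<bar>pressure \<gamma> U * w $ 1 + w $ 1 * (b \<bullet> mag U) - mag U $ 1 * (w \<bullet> b)\<bar>
    \<le> Cspeed \<gamma> U e1 * (internal_energy U + dens U * (norm w)\<^sup>2 / 2 + (norm b)\<^sup>2 / 2)"
    (is "\<bar>?T\<bar> \<le> ?C * ?Q")
proof -
  note adm = admissibleD[OF assms(1)]
  have Cpos: "?C > 0" using Cspeed_props(1)[OF assms] .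
  define s where "s = sqrt (dens U)"
  have s: "s > 0" "s\<^sup>2 = dens U" using adm by (simp_all add: s_def)
  define x where "x = sqrt (internal_energy U)"
  define u where "u i = s * w $ i / sqrt 2" for i
  define y where "y i = b $ i / sqrt 2" for i
  define h where "h i = mag U $ i / s" for i
  define X where "X = sqrt (Cs_sq \<gamma> U) * u 1"
  define Y where "Y i = h i * u 1 - h 1 * u i" for i
  have Cs: "Cs_sq \<gamma> U \<ge> 0" using adm assms(2) by (simp add: Cs_sq_def pressure_def)
  have sq2: "sqrt 2 * sqrt 2 = (2::real)" by simp
  \<comment> \<open>The factor \<open>1 / 2\<close> in \<open>Cs_sq\<close> makes this product equal
    to the pressure; both sides are nonnegative, so their squares are compared.\<close>
  have p: "2 * (x * (sqrt (Cs_sq \<gamma> U) * (s / sqrt 2))) = pressure \<gamma> U"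
  proof -
    have "(2 * (x * (sqrt (Cs_sq \<gamma> U) * (s / sqrt 2))))\<^sup>2 = (pressure \<gamma> U)\<^sup>2"
      using adm Cs by (simp add: power_mult_distrib power_divide x_def s)
        (simp add: Cs_sq_def pressure_def power2_eq_square)
    then show ?thesis
      using adm s(1) assms(2) Cs by (subst (asm) power2_eq_iff_nonneg) (auto simp: x_def pressure_def)
  qed
  have yY: "2 * (y i * Y i) = b $ i * (w $ 1 * mag U $ i - mag U $ 1 * w $ i)" for i
    using s(1) sq2 by (simp add: y_def Y_def h_def u_def field_simps)
  \<comment> \<open>The index 1 contribution drops out, since
    \<open>w $ 1 * mag U $ 1 - mag U $ 1 * w $ 1 = 0\<close>.\<close>
  have T: "?T = 2 * (x * X) + 2 * (y 2 * Y 2) + 2 * (y 3 * Y 3)"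
  proof -
    have "2 * (x * X) = pressure \<gamma> U * w $ 1"
      unfolding X_def u_def p[symmetric] by simp
    then show ?thesis unfolding yY by (simp add: inner_vec_def sum_3 algebra_simps)
  qed
  have "?C * \<bar>?T\<bar> \<le> 2 * ?C * \<bar>x * X\<bar> + 2 * ?C * \<bar>y 2 * Y 2\<bar> + 2 * ?C * \<bar>y 3 * Y 3\<bar>"
  proof -
    have "\<bar>?T\<bar> \<le> 2 * \<bar>x * X\<bar> + 2 * \<bar>y 2 * Y 2\<bar> + 2 * \<bar>y 3 * Y 3\<bar>"
      unfolding T by linarith
    from mult_left_mono[OF this, of ?C] Cpos show ?thesis by (simp add: distrib_left mult_ac)
  qed
  also have "\<dots> \<le> ?C\<^sup>2 * (x\<^sup>2 + (y 2)\<^sup>2 + (y 3)\<^sup>2) + (X\<^sup>2 + (Y 2)\<^sup>2 + (Y 3)\<^sup>2)"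
    using scaled_AM_GM[of ?C x X] scaled_AM_GM[of ?C "y 2" "Y 2"] scaled_AM_GM[of ?C "y 3" "Y 3"]
    by (simp add: distrib_left)
  also have "X\<^sup>2 + (Y 2)\<^sup>2 + (Y 3)\<^sup>2 \<le> ?C\<^sup>2 * ((u 1)\<^sup>2 + (u 2)\<^sup>2 + (u 3)\<^sup>2)"
    using Cspeed_quadratic_form[OF assms, of "u 1" "u 2" "u 3"] Cs
    by (simp add: X_def Y_def h_def s_def power_mult_distrib)
  also have "?C\<^sup>2 * (x\<^sup>2 + (y 2)\<^sup>2 + (y 3)\<^sup>2) + ?C\<^sup>2 * ((u 1)\<^sup>2 + (u 2)\<^sup>2 + (u 3)\<^sup>2) \<le> ?C\<^sup>2 * ?Q"
  proof -
    have x: "x\<^sup>2 = internal_energy U" using adm by (simp add: x_def)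
    have uy: "(u i)\<^sup>2 = dens U * (w $ i)\<^sup>2 / 2" "(y i)\<^sup>2 = (b $ i)\<^sup>2 / 2" for i
      by (simp_all add: u_def y_def power_mult_distrib power_divide s)
    have "(norm w)\<^sup>2 = (w $ 1)\<^sup>2 + (w $ 2)\<^sup>2 + (w $ 3)\<^sup>2"
      "(norm b)\<^sup>2 = (b $ 1)\<^sup>2 + (b $ 2)\<^sup>2 + (b $ 3)\<^sup>2"
      unfolding power2_norm_eq_inner by (simp_all add: inner_vec_def sum_3 power2_eq_square)
    then have "(x\<^sup>2 + (y 2)\<^sup>2 + (y 3)\<^sup>2) + ((u 1)\<^sup>2 + (u 2)\<^sup>2 + (u 3)\<^sup>2) \<le> ?Q"
      unfolding uy x by (simp add: distrib_left add_divide_distrib)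
    from mult_left_mono[OF this, of "?C\<^sup>2"] show ?thesis by (simp add: distrib_left)
  qed
  finally have "?C * \<bar>?T\<bar> \<le> ?C * (?C * ?Q)" by (simp add: power2_eq_square mult.assoc)
  with Cpos show ?thesis by (simp add: mult_le_cancel_left_pos)
qed

lemma roe_vel_commute: "roe_vel U V = roe_vel V U"
  by (simp add: roe_vel_def add.commute)

lemma mag_jump_commute: "mag_jump U V = mag_jump V U"
  by (simp add: mag_jump_def add.commute norm_minus_commute)

text \<open>The square-root weights of the Roe average give
  \<open>(s + t) * norm (roe_vel U V - v) \<le> p + q\<close>, where \<open>p^2\<close> and
  \<open>q^2\<close> are twice the kinetic parts of the test energies. The factor
  \<open>s + t\<close> cancels against the denominator of \<open>mag_jump\<close>, and AM-GM bounds
  the remaining product.\<close>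

lemma jump_term_bound:
  fixes U V :: state and v b :: "real^3"
  assumes "U \<in> admissible" "V \<in> admissible"
  shows "\<bar>(roe_vel U V - v) $ 1 * ((norm (mag U - b))\<^sup>2 - (norm (mag V - b))\<^sup>2) / 2\<bar>
    \<le> mag_jump U V * (gql_energy v b U + gql_energy v b V)"
proof -
  note admU = admissibleD[OF assms(1)] and admV = admissibleD[OF assms(2)]
  define s t where "s = sqrt (dens U)" and "t = sqrt (dens V)"
  have st: "s > 0" "t > 0" "s\<^sup>2 = dens U" "t\<^sup>2 = dens V"
    using admU admV by (simp_all add: s_def t_def)
  define p q where "p = s * norm (vel U - v)" and "q = t * norm (vel V - v)"
  define \<beta> \<delta> where "\<beta> = norm (mag U - b)" and "\<delta> = norm (mag V - b)"
  have nn: "p \<ge> 0" "q \<ge> 0" "\<beta> \<ge> 0" "\<delta> \<ge> 0" using st by (simp_all add: p_def q_def \<beta>_def \<delta>_def)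
  have m: "mag_jump U V \<ge> 0" "norm (mag U - mag V) = mag_jump U V * (s + t)"
    using st by (simp_all add: mag_jump_def s_def[symmetric] t_def[symmetric])
  have "(s + t) *\<^sub>R (roe_vel U V - v) = s *\<^sub>R (vel U - v) + t *\<^sub>R (vel V - v)"
    using st unfolding roe_vel_def s_def[symmetric] t_def[symmetric]
    by (simp add: scaleR_diff_right scaleR_add_left)
  then have "(s + t) * norm (roe_vel U V - v) \<le> p + q"
    using st norm_triangle_ineq[of "s *\<^sub>R (vel U - v)" "t *\<^sub>R (vel V - v)"]
      norm_scaleR[of "s + t" "roe_vel U V - v"]
    by (simp add: p_def q_def)
  then have "norm (roe_vel U V - v) \<le> (p + q) / (s + t)"
    using st by (simp add: pos_le_divide_eq mult.commute)
  then have 1: "\<bar>(roe_vel U V - v) $ 1\<bar> \<le> (p + q) / (s + t)"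
    using component_le_norm_cart[of "roe_vel U V - v" 1] by linarith
  have "\<bar>\<beta>\<^sup>2 - \<delta>\<^sup>2\<bar> = \<bar>\<beta> - \<delta>\<bar> * (\<beta> + \<delta>)"
    using nn by (simp add: power2_eq_square square_diff_square_factored abs_mult)
  also have "\<bar>\<beta> - \<delta>\<bar> \<le> norm (mag U - mag V)"
    using norm_triangle_ineq3[of "mag U - b" "mag V - b"] by (simp add: \<beta>_def \<delta>_def)
  finally have 2: "\<bar>\<beta>\<^sup>2 - \<delta>\<^sup>2\<bar> \<le> mag_jump U V * (s + t) * (\<beta> + \<delta>)"
    using nn by (simp add: m mult_right_mono)
  have "\<bar>(roe_vel U V - v) $ 1\<bar> * \<bar>\<beta>\<^sup>2 - \<delta>\<^sup>2\<bar>
      \<le> ((p + q) / (s + t)) * (mag_jump U V * (s + t) * (\<beta> + \<delta>))"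
    by (rule mult_mono[OF 1 2]) (use nn st in auto)
  also have "\<dots> = mag_jump U V * ((p + q) * (\<beta> + \<delta>))"
    using st by (simp add: field_simps)
  also have "(p + q) * (\<beta> + \<delta>) \<le> p\<^sup>2 + q\<^sup>2 + \<beta>\<^sup>2 + \<delta>\<^sup>2"
    using sum_squares_bound[of p \<beta>] sum_squares_bound[of p \<delta>] sum_squares_bound[of q \<beta>]
      sum_squares_bound[of q \<delta>] by (simp add: algebra_simps)
  also have "p\<^sup>2 + q\<^sup>2 + \<beta>\<^sup>2 + \<delta>\<^sup>2 \<le> 2 * (gql_energy v b U + gql_energy v b V)"
    using admU admV
    by (simp add: gql_energy_def p_def q_def power_mult_distrib st \<beta>_def \<delta>_def)
  finally show ?thesis
    using m by (simp add: abs_mult \<beta>_def \<delta>_def mult_left_mono) (simp add: algebra_simps)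
qed

text \<open>The two states are treated as a pair because the last bracket of
  \<open>flux1_inner_gql\<close> need not have a sign; it cancels between the fluxes since the
  normal fields agree. \<open>Cspeed\<close> absorbs the middle brackets and \<open>mag_jump\<close>
  the jump of the magnetic squares.\<close>

lemma lax_friedrichs_splitting:
  fixes U V :: state and v b :: "real^3"
  assumes "U \<in> admissible" "V \<in> admissible" "mag U $ 1 = mag V $ 1" "\<gamma> > 1"
    and a: "alpha_r \<gamma> U V e1 \<le> a" and a': "a' \<le> alpha_l \<gamma> V U e1"
  shows "(a *\<^sub>R U - flux1 \<gamma> U) \<bullet> gql v b + (flux1 \<gamma> V - a' *\<^sub>R V) \<bullet> gql v b
    + (a - a') * ((norm b)\<^sup>2 / 2) \<ge> 0"
proof -
  note admU = admissibleD[OF assms(1)] and admV = admissibleD[OF assms(2)]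
  define Q R where "Q = gql_energy v b U" and "R = gql_energy v b V"
  define \<beta> \<delta> where "\<beta> = (norm (mag U - b))\<^sup>2 / 2" and "\<delta> = (norm (mag V - b))\<^sup>2 / 2"
  define x y z where "x = vel U $ 1" and "y = vel V $ 1" and "z = roe_vel U V $ 1"
  define m where "m = mag_jump U V"
  let ?C = "Cspeed \<gamma> U e1" and ?D = "Cspeed \<gamma> V e1"
  define T T' where "T = pressure \<gamma> U * (vel U - v) $ 1 + (vel U - v) $ 1 * ((mag U - b) \<bullet> mag U)
        - mag U $ 1 * ((vel U - v) \<bullet> (mag U - b))"
    and "T' = pressure \<gamma> V * (vel V - v) $ 1 + (vel V - v) $ 1 * ((mag V - b) \<bullet> mag V)
        - mag V $ 1 * ((vel V - v) \<bullet> (mag V - b))"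
  have T: "\<bar>T\<bar> \<le> ?C * Q" "\<bar>T'\<bar> \<le> ?D * R"
    unfolding T_def T'_def Q_def R_def gql_energy_def using cross_term_bound assms by blast+
  have Qb: "Q \<ge> \<beta>" "R \<ge> \<delta>" "\<beta> \<ge> 0" "\<delta> \<ge> 0"
    using admU admV by (simp_all add: Q_def R_def \<beta>_def \<delta>_def gql_energy_def)
  have J: "\<bar>(z - v $ 1) * (\<beta> - \<delta>)\<bar> \<le> m * (Q + R)"
    using jump_term_bound[OF assms(1,2), of v b]
    by (simp add: z_def m_def Q_def R_def \<beta>_def \<delta>_def diff_divide_distrib[symmetric])
  \<comment> \<open>Shifting the free \<open>v\<close> by the Roe velocity \<open>z\<close>: the parts of \<open>\<beta>\<close> and \<open>\<delta>\<close> with \<open>x - z\<close>, \<open>y - z\<close>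
    are absorbed by the maximum and minimum in the speeds, the rest by \<open>J\<close>.\<close>
  have "max x z + ?C + m \<le> a" using a by (simp add: alpha_r_def x_def z_def m_def)
  then have "(max x z - x) * Q + (?C + m) * Q \<le> (a - x) * Q"
    using Qb by (simp add: distrib_right[symmetric] mult_right_mono)
  moreover have "(max x z - x) * Q + (x - z) * \<beta> \<ge> 0"
  proof (cases "x \<ge> z")
    case False
    then have "(z - x) * (Q - \<beta>) \<ge> 0" using Qb by simp
    then show ?thesis using False by (simp add: algebra_simps max_def)
  qed (use Qb in \<open>simp add: max_def\<close>)
  ultimately have 1: "(a - x) * Q + (x - z) * \<beta> \<ge> (?C + m) * Q" by linarith
  have "a' \<le> min y z - ?D - m"
    using a' by (simp add: alpha_l_def y_def z_def m_def roe_vel_commute[of V U] mag_jump_commute[of V U])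
  then have "(y - min y z) * R + (?D + m) * R \<le> (y - a') * R"
    using Qb by (simp add: distrib_right[symmetric] mult_right_mono)
  moreover have "(y - min y z) * R - (y - z) * \<delta> \<ge> 0"
  proof (cases "y \<ge> z")
    case True
    then have "(y - z) * (R - \<delta>) \<ge> 0" using Qb by simp
    then show ?thesis using True by (simp add: algebra_simps min_def)
  next
    case False
    then have "(z - y) * \<delta> \<ge> 0" using Qb by simp
    then show ?thesis using False by (simp add: algebra_simps min_def)
  qed
  ultimately have 2: "(y - a') * R - (y - z) * \<delta> \<ge> (?D + m) * R" by linarith
  define n where "n = (norm b)\<^sup>2 / 2"
  have UV: "U \<bullet> gql v b = Q - n" "V \<bullet> gql v b = R - n"
    using gql_affine[OF admU(1), of v b] gql_affine[OF admV(1), of v b]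
    by (simp_all add: Q_def R_def n_def)
  have FU: "flux1 \<gamma> U \<bullet> gql v b = x * Q + T - (x - v $ 1) * \<beta>
      + (mag U $ 1 * (v \<bullet> b) - v $ 1 * n)"
    by (simp add: flux1_inner_gql[OF admU(1)] x_def Q_def T_def \<beta>_def n_def)
  have FV: "flux1 \<gamma> V \<bullet> gql v b = y * R + T' - (y - v $ 1) * \<delta>
      + (mag U $ 1 * (v \<bullet> b) - v $ 1 * n)"
    by (simp add: flux1_inner_gql[OF admV(1)] y_def R_def T'_def \<delta>_def assms(3) n_def)
  have "(a *\<^sub>R U - flux1 \<gamma> U) \<bullet> gql v b + (flux1 \<gamma> V - a' *\<^sub>R V) \<bullet> gql v b
    + (a - a') * n =
      ((a - x) * Q + (x - z) * \<beta>) - T + (((y - a') * R - (y - z) * \<delta>) + T') + (z - v $ 1) * (\<beta> - \<delta>)"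
    unfolding inner_diff_left inner_scaleR_left UV FU FV by (simp add: algebra_simps)
  moreover have "(?C + m) * Q + (?D + m) * R = ?C * Q + ?D * R + m * (Q + R)"
    by (simp add: algebra_simps)
  ultimately show ?thesis using 1 2 T J unfolding n_def by linarith
qed

section \<open>Convexity of the entropies\<close>

text \<open>The tangent at \<open>t = 1\<close> lies above the concave power
  \<open>t powr (1 / p)\<close>; this is weighted AM-GM for \<open>t\<close> and
  \<open>1\<close>.\<close>

lemma exp_ln_divide_le:
  fixes t p :: real
  assumes "t > 0" "p > 1"
  shows "exp (ln t / p) \<le> 1 + (t - 1) / p"
  using Youngs_inequality_0[of "1 / p" "1 - 1 / p" t 1] assms
  by (simp add: powr_def field_simps)

text \<open>The hypothesis on \<open>f''\<close> says that \<open>f\<close> is concave as a function of \<open>exp (s / \<gamma>)\<close>.\<close>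

lemma le_exp_tangent:
  fixes f f' f'' :: "real \<Rightarrow> real"
  assumes "\<gamma> > 0"
    and f: "\<And>s. (f has_real_derivative f' s) (at s)"
    and f': "\<And>s. (f' has_real_derivative f'' s) (at s)"
    and le: "\<And>s. \<gamma> * f'' s \<le> f' s"
  shows "f s \<le> f a + \<gamma> * f' a * (exp ((s - a) / \<gamma>) - 1)"
proof -
  \<comment> \<open>Up to the factor \<open>\<gamma>\<close>, \<open>g\<close> is the derivative of
    \<open>f\<close> with respect to \<open>exp (s / \<gamma>)\<close>.\<close>
  define g where "g s = f' s * exp (- (s / \<gamma>))" for s
  have g: "(g has_real_derivative (f'' s - f' s / \<gamma>) * exp (- (s / \<gamma>))) (at s)" for s
  proof -
    have "\<gamma> \<noteq> 0" using assms(1) by simp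
    then show ?thesis
      unfolding g_def by (auto intro!: derivative_eq_intros f' simp: field_simps)
  qed
  have "(f'' s - f' s / \<gamma>) * exp (- (s / \<gamma>)) \<le> 0" for s
    using le[of s] assms(1) by (intro mult_nonpos_nonneg) (auto simp: field_simps)
  then have g_mono: "g y \<le> g x" if "x \<le> y" for x y
    using DERIV_nonpos_imp_nonincreasing[OF that, of g] g by blast
  \<comment> \<open>\<open>D\<close> is the tangent at \<open>a\<close> minus \<open>f\<close>. By
    monotonicity of \<open>g\<close> it decreases before \<open>a\<close> and increases after, so
    its minimum is \<open>D a = 0\<close>.\<close>
  define D where "D s = f a + \<gamma> * f' a * (exp ((s - a) / \<gamma>) - 1) - f s" for s
  have D: "(D has_real_derivative (g a - g s) * exp (s / \<gamma>)) (at s)" for s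
  proof -
    have "\<gamma> \<noteq> 0" using assms(1) by simp
    then have "(D has_real_derivative f' a * exp ((s - a) / \<gamma>) - f' s) (at s)"
      unfolding D_def by (auto intro!: derivative_eq_intros f)
    moreover have "exp (- (a / \<gamma>)) * exp (s / \<gamma>) = exp ((s - a) / \<gamma>)"
      "exp (- (s / \<gamma>)) * exp (s / \<gamma>) = 1"
      by (simp_all add: exp_add[symmetric] diff_divide_distrib)
    ultimately show ?thesis by (simp add: g_def left_diff_distrib mult.assoc)
  qed
  have "D a \<le> D s"
  proof (cases "a \<le> s")
    case True
    show ?thesis
    proof (rule DERIV_nonneg_imp_nondecreasing[OF True, of D])
      fix x assume "a \<le> x" "x \<le> s"
      then have "(g a - g x) * exp (x / \<gamma>) \<ge> 0" using g_mono[of a x] by simp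
      with D show "\<exists>y. DERIV D x :> y \<and> 0 \<le> y" by blast
    qed
  next
    case False
    then have "s \<le> a" by simp
    show ?thesis
    proof (rule DERIV_nonpos_imp_nonincreasing[OF \<open>s \<le> a\<close>, of D])
      fix x assume "s \<le> x" "x \<le> a"
      then have "(g a - g x) * exp (x / \<gamma>) \<le> 0" using g_mono[of x a] by (simp add: mult_nonpos_nonneg)
      with D show "\<exists>y. DERIV D x :> y \<and> y \<le> 0" by blast
    qed
  qed
  then show ?thesis by (simp add: D_def)
qed

section \<open>Gradients of the internal energy and the entropies\<close>

lemma gradient_eqI:
  assumes "GDERIV g x :> D"
  shows "gradient g x = D"
  unfolding gradient_def
proof (rule the_equality)
  fix D' assume "GDERIV g x :> D'"
  with assms have "(\<lambda>h. h \<bullet> D') = (\<lambda>h. h \<bullet> D)"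
    unfolding gderiv_def using has_derivative_unique by blast
  then have "(D' - D) \<bullet> D' = (D' - D) \<bullet> D" by meson
  then have "(D' - D) \<bullet> (D' - D) = 0" by (simp add: inner_diff_right)
  then show "D' = D" by simp
qed (fact assms)

text \<open>Identifies the test at the state's own velocity and field as the tangent functional of
  the internal energy.\<close>

lemma internal_energy_derivative:
  assumes "dens W > 0"
  shows "(internal_energy has_derivative (\<lambda>h. h \<bullet> gql (vel W) (mag W))) (at W)"
proof -
  have der: "(dens has_derivative dens) (at W)" "(mom has_derivative mom) (at W)"
    "(mag has_derivative mag) (at W)" "(energy has_derivative energy) (at W)"
    unfolding dens_def[abs_def] mom_def[abs_def] mag_def[abs_def] energy_def[abs_def]
    by (intro has_derivative_fst has_derivative_snd has_derivative_ident)+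
  have "(internal_energy has_derivative (\<lambda>h. energy h - ((mom W \<bullet> mom h + mom h \<bullet> mom W) * (2 * dens W) -
      (mom W \<bullet> mom W) * (2 * dens h)) / (2 * dens W * (2 * dens W))
      - (mag W \<bullet> mag h + mag h \<bullet> mag W) / 2)) (at W)"
    unfolding internal_energy_def[abs_def] power2_norm_eq_inner
    by (intro has_derivative_diff has_derivative_divide' bounded_linear.has_derivative[OF bounded_linear_divide]
        has_derivative_mult_right has_derivative_inner der) (use assms in simp)
  moreover have "energy h - ((mom W \<bullet> mom h + mom h \<bullet> mom W) * (2 * dens W) -
      (mom W \<bullet> mom W) * (2 * dens h)) / (2 * dens W * (2 * dens W))
      - (mag W \<bullet> mag h + mag h \<bullet> mag W) / 2 = h \<bullet> gql (vel W) (mag W)" for h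
    using assms by (simp add: inner_gql vel_def inner_commute[of "mom h"] inner_commute[of "mag h"])
     (simp add: field_simps)
  ultimately show ?thesis by simp
qed

lemma inner_dens: "U \<bullet> ((1, 0, 0, 0) :: state) = dens U"
  by (cases U) (simp add: dens_def)

text \<open>The chain rule expresses the entropy variables through the two kinds of admissibility
  functional, density and \<open>gql\<close>, so that convexity can reuse
  \<open>gql_affine\<close>.\<close>

lemma entropy_var_eq:
  assumes "W \<in> admissible" "\<gamma> > 1" "(f has_real_derivative f') (at (spec_entropy \<gamma> W))"
  shows "entropy_var \<gamma> f W = (\<gamma> * f' - f (spec_entropy \<gamma> W)) *\<^sub>R (1, 0, 0, 0)
    - (dens W * f' / internal_energy W) *\<^sub>R gql (vel W) (mag W)"
proof -
  note adm = admissibleD[OF assms(1)]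
  have dens: "(dens has_derivative dens) (at W)"
    unfolding dens_def[abs_def] by (intro has_derivative_fst has_derivative_ident)
  have ie: "(internal_energy has_derivative (\<lambda>h. h \<bullet> gql (vel W) (mag W))) (at W)"
    by (rule internal_energy_derivative[OF adm(1)])
  have "pressure \<gamma> W > 0" using adm assms(2) by (simp add: pressure_def)
  then have "(spec_entropy \<gamma> has_derivative
      (\<lambda>h. ((\<gamma> - 1) * (h \<bullet> gql (vel W) (mag W))) * inverse (pressure \<gamma> W)
        - \<gamma> * (dens h * inverse (dens W)))) (at W)"
    unfolding spec_entropy_def[abs_def] pressure_def
    by (intro has_derivative_diff has_derivative_mult_right has_derivative_ln ie dens adm)
  then have spec: "(spec_entropy \<gamma> has_derivative
      (\<lambda>h. h \<bullet> gql (vel W) (mag W) / internal_energy W - \<gamma> * (dens h / dens W))) (at W)"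
    by (rule has_derivative_eq_rhs)
      (use adm assms(2) in \<open>simp add: fun_eq_iff pressure_def divide_inverse\<close>)
  have "(eta \<gamma> f has_derivative (\<lambda>h. - dens W * (((h \<bullet> gql (vel W) (mag W) / internal_energy W
      - \<gamma> * (dens h / dens W))) * f') + - dens h * f (spec_entropy \<gamma> W))) (at W)"
    unfolding eta_def[abs_def]
    by (intro has_derivative_mult has_derivative_minus DERIV_compose_FDERIV[OF assms(3) spec] dens)
  moreover have "- dens W * (((h \<bullet> gql (vel W) (mag W) / internal_energy W
      - \<gamma> * (dens h / dens W))) * f') + - dens h * f (spec_entropy \<gamma> W) =
    h \<bullet> ((\<gamma> * f' - f (spec_entropy \<gamma> W)) *\<^sub>R (1, 0, 0, 0)
    - (dens W * f' / internal_energy W) *\<^sub>R gql (vel W) (mag W))" for h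
    unfolding inner_diff_right inner_scaleR_right inner_dens
    using adm by (simp add: field_simps)
  ultimately have "GDERIV (eta \<gamma> f) W :> (\<gamma> * f' - f (spec_entropy \<gamma> W)) *\<^sub>R (1, 0, 0, 0)
    - (dens W * f' / internal_energy W) *\<^sub>R gql (vel W) (mag W)"
    unfolding gderiv_def by simp
  then show ?thesis unfolding entropy_var_def by (rule gradient_eqI)
qed

text \<open>Three tangent inequalities are chained: concavity of \<open>f\<close> in
  \<open>exp (s / \<gamma>)\<close>, of the power \<open>1 / \<gamma>\<close>, and of the internal
  energy in the state. Positivity of \<open>deriv f\<close> preserves their direction under
  multiplication.\<close>

lemma rel_entropy_nonneg:
  assumes "C2_real f" "\<And>s. deriv f s > 0" "\<And>s. deriv f s - \<gamma> * deriv (deriv f) s > 0"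
    and "\<gamma> > 1" "U \<in> admissible" "W \<in> admissible"
  shows "rel_entropy \<gamma> f U W \<ge> 0"
proof -
  note admU = admissibleD[OF assms(5)] and admW = admissibleD[OF assms(6)]
  define s a where "s = spec_entropy \<gamma> U" and "a = spec_entropy \<gamma> W"
  define \<rho> r where "\<rho> = dens U" and "r = dens W"
  define \<epsilon> e where "\<epsilon> = internal_energy U" and "e = internal_energy W"
  have pos: "\<rho> > 0" "r > 0" "\<epsilon> > 0" "e > 0"
    using admU admW by (simp_all add: \<rho>_def r_def \<epsilon>_def e_def)
  have f: "(f has_real_derivative deriv f x) (at x)"
    and f': "(deriv f has_real_derivative deriv (deriv f) x) (at x)" for x
    using assms(1) unfolding C2_real_def
    by (auto simp: differentiable_on_def DERIV_deriv_iff_real_differentiable)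
  have "(s - a) / \<gamma> = ln (\<epsilon> / e) / \<gamma> + ln (r / \<rho>)"
    using pos assms(4)
    by (simp add: s_def a_def spec_entropy_def pressure_def \<rho>_def[symmetric] r_def[symmetric]
        \<epsilon>_def[symmetric] e_def[symmetric] ln_mult_pos ln_div)
      (simp add: field_simps)
  then have "\<rho> * exp ((s - a) / \<gamma>) = r * exp (ln (\<epsilon> / e) / \<gamma>)"
    using pos by (simp add: exp_add)
  also have "\<dots> \<le> r * (1 + (\<epsilon> / e - 1) / \<gamma>)"
    using pos assms(4) by (intro mult_left_mono exp_ln_divide_le) auto
  finally have X: "\<gamma> * deriv f a * (\<rho> * exp ((s - a) / \<gamma>))
      \<le> \<gamma> * deriv f a * (r * (1 + (\<epsilon> / e - 1) / \<gamma>))"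
    using assms(2)[of a] assms(4) by (intro mult_left_mono) auto
  have "\<gamma> * deriv (deriv f) x \<le> deriv f x" for x
    using assms(3)[of x] by simp
  then have "f s \<le> f a + \<gamma> * deriv f a * (exp ((s - a) / \<gamma>) - 1)"
    using le_exp_tangent[OF _ f f'] assms(4) by simp
  then have "\<rho> * f s \<le> \<rho> * (f a + \<gamma> * deriv f a * (exp ((s - a) / \<gamma>) - 1))"
    using pos by (intro mult_left_mono) auto
  moreover have "\<gamma> * deriv f a * (r * (1 + (\<epsilon> / e - 1) / \<gamma>))
      = \<gamma> * deriv f a * r + deriv f a * r * (\<epsilon> / e - 1)"
    using assms(4) by (simp add: distrib_left)
  ultimately have main: "\<rho> * f s \<le> \<rho> * f a + \<gamma> * deriv f a * (r - \<rho>) + deriv f a * r * (\<epsilon> / e - 1)"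
    using X by (simp add: algebra_simps)
  \<comment> \<open>Dropping the two squares in \<open>gql_energy\<close> gives the tangent
    inequality for the internal energy at \<open>W\<close>.\<close>
  have "gql_energy (vel W) (mag W) U \<ge> \<epsilon>"
    using admU by (simp add: gql_energy_def \<epsilon>_def)
  then have "(U - W) \<bullet> gql (vel W) (mag W) \<ge> \<epsilon> - e"
    using gql_affine[OF admU(1), of "vel W" "mag W"] internal_energy_eq_gql[OF admW(1)]
    by (simp add: inner_diff_left e_def)
  then have "(r * deriv f a / e) * ((U - W) \<bullet> gql (vel W) (mag W)) \<ge> (r * deriv f a / e) * (\<epsilon> - e)"
    using pos assms(2)[of a] by (intro mult_left_mono) auto
  moreover have "entropy_var \<gamma> f W \<bullet> (U - W) = (\<gamma> * deriv f a - f a) * (\<rho> - r)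
      - (r * deriv f a / e) * ((U - W) \<bullet> gql (vel W) (mag W))"
    unfolding entropy_var_eq[OF assms(6,4) f] inner_commute[of _ "U - W"]
      inner_diff_right[of "U - W"] inner_scaleR_right inner_dens
    by (simp add: a_def r_def \<rho>_def e_def)
  moreover have "(r * deriv f a / e) * (\<epsilon> - e) = deriv f a * r * (\<epsilon> / e - 1)"
    using pos by (simp add: field_simps)
  ultimately show ?thesis
    using main unfolding rel_entropy_def eta_def
    by (simp add: \<rho>_def[symmetric] r_def[symmetric] s_def[symmetric] a_def[symmetric] algebra_simps)
qed

section \<open>Admissibility of the update\<close>

text \<open>A pair holds the normal and the offset of an affine inequality. Listing density among
  the tests lets later arguments treat all constraints alike.\<close>

definition adm_tests :: "(state \<times> real) set" where
  "adm_tests = insert ((1, 0, 0, 0), 0) (range (\<lambda>(v, b). (gql v b, (norm b)\<^sup>2 / 2)))"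

lemma admissible_iff_tests: "U \<in> admissible \<longleftrightarrow> (\<forall>(g, c) \<in> adm_tests. U \<bullet> g + c > 0)"
proof
  assume "U \<in> admissible"
  then show "\<forall>(g, c) \<in> adm_tests. U \<bullet> g + c > 0"
    using admissibleD(1)[of U] gql_affine[of U] gql_energy_pos[of U]
    by (auto simp: adm_tests_def inner_dens)
next
  assume *: "\<forall>(g, c) \<in> adm_tests. U \<bullet> g + c > 0"
  then have "dens U > 0" by (auto simp: adm_tests_def inner_dens)
  with * show "U \<in> admissible"
    using internal_energy_eq_gql[of U] by (auto simp: adm_tests_def admissible_def)
qed

text \<open>For the density test it is enough that the speeds bound the normal velocities, because
  the density flux is \<open>dens\<close> times that velocity. The other tests are
  \<open>lax_friedrichs_splitting\<close>.\<close>

lemma splitting_tests: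
  assumes "U \<in> admissible" "V \<in> admissible" "mag U $ 1 = mag V $ 1" "\<gamma> > 1"
    and a: "alpha_r \<gamma> U V e1 \<le> a" and a': "a' \<le> alpha_l \<gamma> V U e1"
    and "(g, c) \<in> adm_tests"
  shows "(a *\<^sub>R U - flux1 \<gamma> U) \<bullet> g + (flux1 \<gamma> V - a' *\<^sub>R V) \<bullet> g + (a - a') * c \<ge> 0"
proof -
  have dens: "(a *\<^sub>R U - flux1 \<gamma> U) \<bullet> (1, 0, 0, 0) + (flux1 \<gamma> V - a' *\<^sub>R V) \<bullet> (1, 0, 0, 0) \<ge> 0"
  proof -
    note adm = admissibleD(1)[OF assms(1)] admissibleD(1)[OF assms(2)]
    have "mag_jump U V \<ge> 0" "mag_jump V U \<ge> 0"
      using adm by (simp_all add: mag_jump_def)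
    then have "vel U $ 1 \<le> alpha_r \<gamma> U V e1" "alpha_l \<gamma> V U e1 \<le> vel V $ 1"
      using Cspeed_props(1)[OF assms(1,4)] Cspeed_props(1)[OF assms(2,4)]
      unfolding alpha_r_def alpha_l_def inner_e1 by linarith+
    then have "dens U * (a - vel U $ 1) \<ge> 0" "dens V * (vel V $ 1 - a') \<ge> 0"
      using adm a a' by simp_all
    moreover have "dens (flux1 \<gamma> W) = dens W * vel W $ 1" for W
      by (simp add: flux1_def dens_def)
    ultimately show ?thesis
      by (simp add: inner_dens algebra_simps)
  qed
  from \<open>(g, c) \<in> adm_tests\<close> show ?thesis
    unfolding adm_tests_def using dens lax_friedrichs_splitting[OF assms(1-6)] by auto
qed

text \<open>The intermediate state of the HLL Riemann solver, with \<open>U\<close> on the left and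
  \<open>V\<close> on the right of the fan between the speeds \<open>am\<close> and
  \<open>ap\<close>.\<close>

definition hll_state :: "real \<Rightarrow> real \<Rightarrow> real \<Rightarrow> state \<Rightarrow> state \<Rightarrow> state" where
  "hll_state \<gamma> am ap U V =
    (ap *\<^sub>R V - flux1 \<gamma> V + flux1 \<gamma> U - am *\<^sub>R U) /\<^sub>R (ap - am)"

text \<open>These are the Rankine-Hugoniot relations at the two edges of the fan. Each adjacent cell
  uses the one with its own trace.\<close>

lemma num_flux_eq_hll:
  fixes \<gamma> :: real
  assumes "aminus S i < 0" "aplus S i > 0"
  defines "W \<equiv> hll_state \<gamma> (aminus S i) (aplus S i) (trace_minus S i) (trace_plus S i)"
  shows "num_flux \<gamma> S i = flux1 \<gamma> (trace_minus S i) + aminus S i *\<^sub>R (W - trace_minus S i)"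
    and "num_flux \<gamma> S i = flux1 \<gamma> (trace_plus S i) + aplus S i *\<^sub>R (W - trace_plus S i)"
proof -
  define d where "d = aplus S i - aminus S i"
  have d: "d \<noteq> 0" using assms by (simp add: d_def)
  have F: "d *\<^sub>R num_flux \<gamma> S i = aplus S i *\<^sub>R flux1 \<gamma> (trace_minus S i)
      - aminus S i *\<^sub>R flux1 \<gamma> (trace_plus S i)
      + (aplus S i * aminus S i) *\<^sub>R (trace_plus S i - trace_minus S i)"
    using d by (simp add: num_flux_def Let_def d_def)
  have W: "d *\<^sub>R W = aplus S i *\<^sub>R trace_plus S i - flux1 \<gamma> (trace_plus S i)
      + flux1 \<gamma> (trace_minus S i) - aminus S i *\<^sub>R trace_minus S i"
    using d by (simp add: W_def hll_state_def d_def)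
  have "d *\<^sub>R num_flux \<gamma> S i
    = d *\<^sub>R flux1 \<gamma> (trace_minus S i) + aminus S i *\<^sub>R (d *\<^sub>R W - d *\<^sub>R trace_minus S i)"
    unfolding F W by (simp add: d_def algebra_simps)
  then have "d *\<^sub>R num_flux \<gamma> S i
    = d *\<^sub>R (flux1 \<gamma> (trace_minus S i) + aminus S i *\<^sub>R (W - trace_minus S i))"
    by (simp add: algebra_simps)
  then show "num_flux \<gamma> S i = flux1 \<gamma> (trace_minus S i) + aminus S i *\<^sub>R (W - trace_minus S i)"
    using d by simp
  have "d *\<^sub>R num_flux \<gamma> S i
    = d *\<^sub>R flux1 \<gamma> (trace_plus S i) + aplus S i *\<^sub>R (d *\<^sub>R W - d *\<^sub>R trace_plus S i)"
    unfolding F W by (simp add: d_def algebra_simps)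
  then have "d *\<^sub>R num_flux \<gamma> S i
    = d *\<^sub>R (flux1 \<gamma> (trace_plus S i) + aplus S i *\<^sub>R (W - trace_plus S i))"
    by (simp add: algebra_simps)
  then show "num_flux \<gamma> S i = flux1 \<gamma> (trace_plus S i) + aplus S i *\<^sub>R (W - trace_plus S i)"
    using d by simp
qed

text \<open>Up to the positive factor \<open>ap - am\<close>, the state is a Lax-Friedrichs pair in
  which \<open>V\<close> carries the upper and \<open>U\<close> the lower speed.\<close>

lemma hll_state_tests:
  assumes "U \<in> admissible" "V \<in> admissible" "mag U $ 1 = mag V $ 1" "\<gamma> > 1"
    and "alpha_r \<gamma> V U e1 \<le> ap" "am \<le> alpha_l \<gamma> U V e1" "am < ap" "(g, c) \<in> adm_tests"
  shows "hll_state \<gamma> am ap U V \<bullet> g + c \<ge> 0"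
proof -
  have "(ap - am) *\<^sub>R hll_state \<gamma> am ap U V = (ap *\<^sub>R V - flux1 \<gamma> V) + (flux1 \<gamma> U - am *\<^sub>R U)"
    using assms(7) by (simp add: hll_state_def)
  then have "(ap - am) * (hll_state \<gamma> am ap U V \<bullet> g + c) =
    (ap *\<^sub>R V - flux1 \<gamma> V) \<bullet> g + (flux1 \<gamma> U - am *\<^sub>R U) \<bullet> g + (ap - am) * c"
    by (metis distrib_left inner_add_left inner_scaleR_left)
  also have "\<dots> \<ge> 0"
    by (rule splitting_tests) (use assms in auto)
  finally show ?thesis using assms(7) by (simp add: zero_le_mult_iff)
qed

lemma mag1_flux1: "mag (flux1 \<gamma> U) $ 1 = 0"
  by (simp add: flux1_def mag_def)

text \<open>Both ends of the cell use the intermediate HLL state of their interface, so that what is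
  left of the flux difference is the cell-internal splitting of \<open>UR\<close> and \<open>UL\<close>.\<close>

lemma cell_update_admissible:
  fixes UL UR SL SR A :: state
  assumes "UL \<in> admissible" "UR \<in> admissible" "mag UL $ 1 = mag UR $ 1" "\<gamma> > 1"
    and SL: "\<And>g c. (g, c) \<in> adm_tests \<Longrightarrow> SL \<bullet> g + c \<ge> 0"
    and SR: "\<And>g c. (g, c) \<in> adm_tests \<Longrightarrow> SR \<bullet> g + c \<ge> 0"
    and A: "\<And>g c. (g, c) \<in> adm_tests \<Longrightarrow> A \<bullet> g + c \<ge> \<omega> * (UL \<bullet> g + c) + \<omega> * (UR \<bullet> g + c)"
    and al: "alpha_r \<gamma> UR UL e1 \<le> al" "- al \<le> alpha_l \<gamma> UL UR e1"
    and th: "0 \<le> \<theta>" "\<theta> * (al + ap) < \<omega>" "\<theta> * (al - am) < \<omega>" "am < 0" "0 < ap"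
  shows "A - \<theta> *\<^sub>R ((flux1 \<gamma> UR + am *\<^sub>R (SR - UR)) - (flux1 \<gamma> UL + ap *\<^sub>R (SL - UL))) \<in> admissible"
    (is "?W \<in> _")
  unfolding admissible_iff_tests
proof (intro ballI, clarify)
  fix g :: state and c :: real
  assume gc: "(g, c) \<in> adm_tests"
  define l where "l U = U \<bullet> g + c" for U :: state
  have l: "l UL > 0" "l UR > 0" "l SL \<ge> 0" "l SR \<ge> 0"
    using assms(1,2) SL[OF gc] SR[OF gc] gc unfolding admissible_iff_tests l_def by auto
  \<comment> \<open>The splitting inside the cell uses the symmetric speeds \<open>al\<close> and
    \<open>- al\<close>, with \<open>UR\<close> in the first role.\<close>
  have "(al *\<^sub>R UR - flux1 \<gamma> UR) \<bullet> g + (flux1 \<gamma> UL - (- al) *\<^sub>R UL) \<bullet> g + (al - (- al)) * c \<ge> 0"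
    by (rule splitting_tests) (use assms gc in auto)
  then have split: "al * l UR + al * l UL - (flux1 \<gamma> UR \<bullet> g - flux1 \<gamma> UL \<bullet> g) \<ge> 0" (is "?s \<ge> 0")
    by (simp add: l_def inner_diff_left inner_add_left algebra_simps)
  have "?W \<bullet> g + c = l A - \<theta> * ((flux1 \<gamma> UR \<bullet> g - flux1 \<gamma> UL \<bullet> g)
      + am * (l SR - l UR) - ap * (l SL - l UL))"
    by (simp add: l_def inner_diff_left inner_add_left algebra_simps)
  also have "\<dots> \<ge> \<omega> * l UL + \<omega> * l UR - \<theta> * ((flux1 \<gamma> UR \<bullet> g - flux1 \<gamma> UL \<bullet> g)
      + am * (l SR - l UR) - ap * (l SL - l UL))"
    using A[OF gc] by (simp add: l_def)
  also have "\<omega> * l UL + \<omega> * l UR - \<theta> * ((flux1 \<gamma> UR \<bullet> g - flux1 \<gamma> UL \<bullet> g)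
      + am * (l SR - l UR) - ap * (l SL - l UL)) =
    (\<omega> - \<theta> * (al + ap)) * l UL + (\<omega> - \<theta> * (al - am)) * l UR
      + \<theta> * (ap * l SL) + \<theta> * (- am * l SR) + \<theta> * ?s"
    by (simp add: algebra_simps)
  finally have "?W \<bullet> g + c \<ge> (\<omega> - \<theta> * (al + ap)) * l UL + (\<omega> - \<theta> * (al - am)) * l UR
      + \<theta> * (ap * l SL) + \<theta> * (- am * l SR) + \<theta> * ?s" .
  \<comment> \<open>Strictness comes from the two end states, whose coefficients stay positive under
    the CFL conditions; the other terms are only known to be nonnegative.\<close>
  moreover have "(\<omega> - \<theta> * (al + ap)) * l UL > 0" "(\<omega> - \<theta> * (al - am)) * l UR > 0"
    using th l by simp_all
  moreover have "\<theta> * (ap * l SL) \<ge> 0" "\<theta> * (- am * l SR) \<ge> 0" "\<theta> * ?s \<ge> 0"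
    using th l split by (intro mult_nonneg_nonneg; simp)+
  ultimately show "?W \<bullet> g + c > 0" by linarith
qed

section \<open>Exact quadrature of cell averages\<close>

lemma integral_affine_poly:
  fixes p :: "real poly"
  assumes "h > 0"
  shows "integral {-1..1} (\<lambda>t. poly p (a + h / 2 * (1 + t))) = 2 / h * integral {a..a + h} (poly p)"
proof -
  have "(poly p has_integral integral {a..a + h} (poly p)) (cbox a (a + h))"
    by (intro integrable_integral[unfolded box_real] integrable_continuous_real continuous_intros
        | simp)+
  from has_integral_affinity[OF this, of "h / 2" "a + h / 2"] assms
  have "((\<lambda>t. poly p (h / 2 * t + (a + h / 2))) has_integral
      (2 / h * integral {a..a + h} (poly p))) ((\<lambda>x. x * 2 / h - (a + h / 2) * 2 / h) ` cbox a (a + h))"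
    by (simp add: field_simps)
  moreover have "(\<lambda>x. x * 2 / h - (a + h / 2) * 2 / h) ` cbox a (a + h) = {-1..1}"
  proof (intro equalityI subsetI)
    fix t assume "t \<in> {-1..1::real}"
    then have "a + h / 2 * (1 + t) \<in> cbox a (a + h)"
      using assms mult_left_mono[of "1 + t" 2 "h / 2"] by simp
    moreover have "t = (a + h / 2 * (1 + t)) * 2 / h - (a + h / 2) * 2 / h"
      using assms by (simp add: field_simps)
    ultimately show "t \<in> (\<lambda>x. x * 2 / h - (a + h / 2) * 2 / h) ` cbox a (a + h)" by blast
  qed (use assms in \<open>auto simp: field_simps\<close>)
  ultimately show ?thesis
    by (intro integral_unique) (simp add: algebra_simps add_divide_distrib)
qed

lemma cell_avg_quadrature:
  assumes rule: "gauss_lobatto (nnodes S) (node S) (weight S)"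
    and "dx S > 0" "2 * nnodes S - 3 \<ge> k" "j \<ge> 1" and poly: "poly_on k (cell S j) (sol S j)"
  shows "cell_avg S j = (\<Sum>i=1..nnodes S. weight S i *\<^sub>R quad_state S j i)"
proof (rule euclidean_eqI)
  fix b :: state assume b: "b \<in> Basis"
  obtain p :: "real poly" where p: "degree p \<le> k" "\<And>x. x \<in> cell S j \<Longrightarrow> sol S j x \<bullet> b = poly p x"
    using poly b unfolding poly_on_def by blast
  define a where "a = face S (j - 1)"
  have cell: "cell S j = {a..a + dx S}"
    using assms(4) by (simp add: cell_def face_def a_def of_nat_diff algebra_simps)
  define q where "q = pcompose p [:a + dx S / 2, dx S / 2:]"
  have q: "poly q t = poly p (a + dx S / 2 * (1 + t))" for t
    by (simp add: q_def poly_pcompose) (simp add: field_simps)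
  have "degree q \<le> 2 * nnodes S - 3"
    using p(1) assms(2,3) by (simp add: q_def degree_pcompose)
  then have quad: "(\<Sum>i=1..nnodes S. weight S i * poly q (node S i)) = 1 / 2 * integral {-1..1} (poly q)"
    using rule unfolding gauss_lobatto_def by blast
  \<comment> \<open>\<open>sol S j\<close> is known to agree with \<open>p\<close> on the cell only,
    so the nodes must lie in the reference interval.\<close>
  have node: "-1 \<le> node S i" "node S i \<le> 1" if "i \<in> {1..nnodes S}" for i
  proof -
    have *: "strict_mono_on {1..nnodes S} (node S)" "node S 1 = -1" "node S (nnodes S) = 1" "nnodes S \<ge> 2"
      using rule unfolding gauss_lobatto_def by auto
    show "-1 \<le> node S i"
      using strict_mono_on_leD[OF *(1), of 1 i] that *(2) by auto
    show "node S i \<le> 1"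
      using strict_mono_on_leD[OF *(1), of i "nnodes S"] that *(3) by auto
  qed
  have integrable: "sol S j integrable_on cell S j"
  proof (subst integrable_componentwise_iff, intro ballI)
    fix b' :: state assume "b' \<in> Basis"
    then obtain p' :: "real poly" where "\<And>x. x \<in> cell S j \<Longrightarrow> sol S j x \<bullet> b' = poly p' x"
      using poly unfolding poly_on_def by blast
    then show "(\<lambda>x. sol S j x \<bullet> b') integrable_on cell S j"
      using integrable_cong[of "cell S j" "\<lambda>x. sol S j x \<bullet> b'" "poly p'"] unfolding cell
      by (simp add: integrable_continuous_real continuous_on_poly)
  qed
  have "integral (cell S j) (sol S j) \<bullet> b = integral (cell S j) (\<lambda>x. sol S j x \<bullet> b)"
    using integral_component_eq[OF integrable] by simp
  also have "\<dots> = integral {a..a + dx S} (poly p)"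
    unfolding cell[symmetric] by (rule integral_cong) (rule p(2))
  also have "\<dots> = dx S * (1 / 2 * integral {-1..1} (poly q))"
    using integral_affine_poly[OF assms(2), of p a] assms(2) by (simp add: q[abs_def])
  finally have int: "integral (cell S j) (sol S j) \<bullet> b = dx S * (1 / 2 * integral {-1..1} (poly q))" .
  have "cell_avg S j \<bullet> b = (\<Sum>i=1..nnodes S. weight S i * poly q (node S i))"
    unfolding quad cell_avg_def inner_scaleR_left int using assms(2) by simp
  also have "\<dots> = (\<Sum>i=1..nnodes S. weight S i * (quad_state S j i \<bullet> b))"
  proof (intro sum.cong refl)
    fix i assume "i \<in> {1..nnodes S}"
    then have "0 \<le> dx S * (1 + node S i)" "dx S * (1 + node S i) \<le> dx S * 2"
      using node[of i] assms(2) by (intro mult_nonneg_nonneg mult_left_mono; simp)+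
    then have "quad_point S j i \<in> cell S j"
      unfolding cell quad_point_def a_def[symmetric] by simp
    then show "weight S i * poly q (node S i) = weight S i * (quad_state S j i \<bullet> b)"
      by (simp add: q quad_state_def p(2) quad_point_def a_def)
  qed
  finally show "cell_avg S j \<bullet> b = (\<Sum>i=1..nnodes S. weight S i *\<^sub>R quad_state S j i) \<bullet> b"
    by (simp add: inner_sum_left)
qed

section \<open>Entropy stability\<close>

text \<open>For \<open>P > 0\<close> the bound \<open>c\<close> is finite, since otherwise
  \<open>\<omega> / c = 0 < t\<close>. Then \<open>H > 0\<close>, because a positive numerator over
  zero is infinite, and real arithmetic remains.\<close>

lemma ennreal_rate_bound:
  assumes "0 < t" "0 \<le> P" "0 \<le> H" "0 < \<omega>"
    and "ennreal P / ennreal H \<le> c" "ennreal t \<le> ennreal \<omega> / c"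
  shows "t * P \<le> \<omega> * H"
proof (cases "P = 0")
  case False
  then have P: "P > 0" using assms by simp
  have c: "c \<noteq> top"
  proof
    assume "c = top"
    then show False using assms(1,6) by (simp add: ennreal_le_iff2 split: if_splits)
  qed
  then have "H \<noteq> 0"
    using assms(5) P by (auto simp: ennreal_divide_zero top_unique)
  then have H: "H > 0" using assms by simp
  obtain r where r: "c = ennreal r" "r \<ge> 0" using c by (cases c) auto
  have le: "P / H \<le> r" using assms(5) P H r by (simp add: divide_ennreal)
  moreover have "P / H > 0" using P H by simp
  ultimately have rpos: "r > 0" by linarith
  then have "t \<le> \<omega> / r" using assms r by (simp add: divide_ennreal)
  then have "t * r \<le> \<omega>" using rpos by (simp add: pos_le_divide_eq)
  then have "t * r * H \<le> \<omega> * H" using H by (intro mult_right_mono) auto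
  moreover have "t * P \<le> t * (r * H)"
    using le H assms(1) by (intro mult_left_mono) (auto simp: pos_divide_le_eq)
  ultimately show ?thesis by (simp add: mult.assoc)
qed (use assms in simp)

text \<open>The potentials cancel in the sum of the two defects, and the linear terms of the
  relative entropies average to \<open>t\<close> times the flux difference paired with
  \<open>entropy_var \<gamma> f W\<close>.\<close>

lemma entropy_balance:
  fixes \<gamma> t :: real
  assumes avg: "cell_avg S j = (\<Sum>i=1..nnodes S. weight S i *\<^sub>R quad_state S j i)"
    and w: "(\<Sum>i=1..nnodes S. weight S i) = 1"
  defines "W \<equiv> update \<gamma> S t j"
  shows "eta \<gamma> f W - budget \<gamma> f S t j = t * (defect_L \<gamma> f S j W + defect_R \<gamma> f S j W)
    - (\<Sum>i=1..nnodes S. weight S i * rel_entropy \<gamma> f (quad_state S j i) W)"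
proof -
  let ?V = "entropy_var \<gamma> f W" and ?F = "num_flux \<gamma> S j - num_flux \<gamma> S (j - 1)"
  have "(\<Sum>i=1..nnodes S. weight S i * rel_entropy \<gamma> f (quad_state S j i) W)
    = (\<Sum>i=1..nnodes S. weight S i * eta \<gamma> f (quad_state S j i))
      - (\<Sum>i=1..nnodes S. weight S i) * eta \<gamma> f W
      - ?V \<bullet> ((\<Sum>i=1..nnodes S. weight S i *\<^sub>R quad_state S j i) - (\<Sum>i=1..nnodes S. weight S i) *\<^sub>R W)"
    by (simp add: rel_entropy_def right_diff_distrib sum_subtractf inner_diff_right inner_sum_right
        sum_distrib_right inner_scaleR_right scaleR_sum_left)
  also have "\<dots> = (\<Sum>i=1..nnodes S. weight S i * eta \<gamma> f (quad_state S j i)) - eta \<gamma> f W - t * (?V \<bullet> ?F)"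
    unfolding w avg[symmetric] by (simp add: W_def update_def)
  finally show ?thesis
    by (simp add: budget_def defect_L_def defect_R_def inner_diff_right algebra_simps)
qed

theorem theorem2p9:
  fixes \<gamma> \<sigma> Bc :: real
    and f :: "nat \<Rightarrow> real \<Rightarrow> real"
    and M k :: nat
    and S :: scheme
  assumes gamma: "\<gamma> > 1"
    and sigma: "0 < \<sigma>" "\<sigma> < 1"
    and M: "M \<ge> 1"
    and f_C2: "\<And>r. r \<in> {1..M} \<Longrightarrow> C2_real (f r)"
    and f_deriv: "\<And>r s. r \<in> {1..M} \<Longrightarrow> deriv (f r) s > 0"
    and f_deriv2: "\<And>r s. r \<in> {1..M} \<Longrightarrow> deriv (f r) s - \<gamma> * deriv (deriv (f r)) s > 0"
    and mesh: "ncells S \<ge> 1" "dx S > 0"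
    and rule: "gauss_lobatto (nnodes S) (node S) (weight S)"
    and deg: "2 * nnodes S - 3 \<ge> k" "k = 0 \<Longrightarrow> nnodes S = 2"
    and sol_poly: "\<And>j. j \<in> {1..ncells S} \<Longrightarrow> poly_on k (cell S j) (sol S j)"
    and sol_B1: "\<And>j x. j \<in> {1..ncells S} \<Longrightarrow> x \<in> cell S j \<Longrightarrow> mag (sol S j x) $ 1 = Bc"
    and quad_adm: "\<And>j i. j \<in> {1..ncells S} \<Longrightarrow> i \<in> {1..nnodes S} \<Longrightarrow>
                     quad_state S j i \<in> admissible_B Bc"
    and ext_adm: "ext_left S \<in> admissible_B Bc" "ext_right S \<in> admissible_B Bc"
    and speed_minus: "\<And>i. i \<in> {0..ncells S} \<Longrightarrow>
          aminus S i < min 0 (alpha_l \<gamma> (trace_minus S i) (trace_plus S i) e1)"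
    and speed_plus: "\<And>i. i \<in> {0..ncells S} \<Longrightarrow>
          aplus S i > max 0 (alpha_r \<gamma> (trace_plus S i) (trace_minus S i) e1)"
    and diss_minus: "\<And>i r. i \<in> {0..ncells S} \<Longrightarrow> r \<in> {1..M} \<Longrightarrow>
          diss_minus \<gamma> (f r) S i > 0 \<or>
          (num_flux \<gamma> S i, num_entropy_flux \<gamma> (f r) S i)
            = (flux1 \<gamma> (trace_minus S i), entropy_flux \<gamma> (f r) (trace_minus S i))"
    and diss_plus: "\<And>i r. i \<in> {0..ncells S} \<Longrightarrow> r \<in> {1..M} \<Longrightarrow>
          diss_plus \<gamma> (f r) S i > 0 \<or>
          (num_flux \<gamma> S i, num_entropy_flux \<gamma> (f r) S i)
            = (flux1 \<gamma> (trace_plus S i), entropy_flux \<gamma> (f r) (trace_plus S i))"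
  shows "\<forall>lam::real. 0 < lam \<and> ennreal lam \<le> lambda_rel \<gamma> \<sigma> f M S \<longrightarrow>
           (\<forall>j\<in>{1..ncells S}. \<forall>r\<in>{1..M}.
              update \<gamma> S lam j \<in> admissible_B Bc \<and>
              eta \<gamma> (f r) (update \<gamma> S lam j) \<le> budget \<gamma> (f r) S lam j)"
proof (intro allI impI ballI, elim conjE)
  fix lam :: real and j r
  assume lam: "0 < lam" "ennreal lam \<le> lambda_rel \<gamma> \<sigma> f M S"
    and j: "j \<in> {1..ncells S}" and r: "r \<in> {1..M}"
  let ?L = "nnodes S" and ?UL = "state_L S j" and ?UR = "state_R S j"
  define W where "W = update \<gamma> S lam j"
  define \<omega> where "\<omega> = weight S 1"
  have gl: "?L \<ge> 2" "\<And>i. i \<in> {1..?L} \<Longrightarrow> weight S i > 0" "(\<Sum>i=1..?L. weight S i) = 1"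
    "weight S ?L = \<omega>"
    using rule unfolding gauss_lobatto_def \<omega>_def by auto
  have om: "\<omega> > 0" using gl unfolding \<omega>_def by simp
  have ends: "1 \<in> {1..?L}" "?L \<in> {1..?L}" "1 \<noteq> ?L" using gl(1) by auto
  have avg: "cell_avg S j = (\<Sum>i=1..?L. weight S i *\<^sub>R quad_state S j i)"
    using cell_avg_quadrature[OF rule mesh(2) deg(1) _ sol_poly[OF j]] j by simp
  \<comment> \<open>Only the two end nodes are kept; they are distinct and both have weight
    \<open>\<omega>\<close>.\<close>
  have end_sum: "\<omega> * g 1 + \<omega> * g ?L \<le> (\<Sum>i=1..?L. weight S i * g i)"
    if "\<And>i. i \<in> {1..?L} \<Longrightarrow> g i \<ge> 0" for g :: "nat \<Rightarrow> real"
  proof -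
    have "(\<Sum>i\<in>{1, ?L}. weight S i * g i) \<le> (\<Sum>i=1..?L. weight S i * g i)"
    proof (rule sum_mono2)
      fix i assume "i \<in> {1..?L} - {1, ?L}"
      then show "0 \<le> weight S i * g i"
        using that gl(2) by (intro mult_nonneg_nonneg less_imp_le[of _ "weight S i"]) auto
    qed (use ends in auto)
    then show ?thesis using ends(3) gl(4) by (simp add: \<omega>_def)
  qed
  have adm: "?UL \<in> admissible_B Bc" "?UR \<in> admissible_B Bc"
    using quad_adm[OF j] ends by (auto simp: state_L_def state_R_def)
  have tr_adm: "trace_minus S i \<in> admissible_B Bc" "trace_plus S i \<in> admissible_B Bc"
    if "i \<in> {0..ncells S}" for i
    using that ext_adm quad_adm[of i ?L] quad_adm[of "i + 1" 1] ends
    by (auto simp: trace_minus_def trace_plus_def state_L_def state_R_def)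
  have ifaces: "j - 1 \<in> {0..ncells S}" "j \<in> {0..ncells S}" using j by auto
  \<comment> \<open>Cell \<open>j\<close> lies between the interfaces \<open>j - 1\<close> and
    \<open>j\<close>; its inner traces are never exterior ones.\<close>
  have traces: "trace_plus S (j - 1) = ?UL" "trace_minus S j = ?UR"
    using j by (auto simp: trace_plus_def trace_minus_def)
  have speeds: "aminus S i < 0" "aplus S i > 0"
    "aminus S i \<le> alpha_l \<gamma> (trace_minus S i) (trace_plus S i) e1"
    "alpha_r \<gamma> (trace_plus S i) (trace_minus S i) e1 \<le> aplus S i"
    if "i \<in> {0..ncells S}" for i
    using speed_minus[OF that] speed_plus[OF that] by auto

  \<comment> \<open>Admissibility and normal magnetic field of the update\<close>
  define H where "H i = hll_state \<gamma> (aminus S i) (aplus S i) (trace_minus S i) (trace_plus S i)" for i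
  have H: "H i \<bullet> g + c \<ge> 0" if "i \<in> {0..ncells S}" "(g, c) \<in> adm_tests" for i g c
    unfolding H_def using that tr_adm[OF that(1)] speeds[OF that(1)] gamma
    by (intro hll_state_tests) (auto simp: admissible_B_def)
  define al where "al = alpha_cell \<gamma> S j"
  have al: "alpha_r \<gamma> ?UR ?UL e1 \<le> al" "- al \<le> alpha_l \<gamma> ?UL ?UR e1"
    unfolding al_def alpha_cell_def alpha_star_def alpha_r_def alpha_l_def by linarith+
  have al_pos: "al > 0"
  proof -
    have "Cspeed \<gamma> ?UR e1 > 0" using Cspeed_props(1) adm gamma by (auto simp: admissible_B_def)
    moreover have "mag_jump ?UR ?UL \<ge> 0"
      using adm by (auto simp: mag_jump_def admissible_B_def admissible_def)
    ultimately show ?thesis unfolding al_def alpha_cell_def alpha_star_def by linarith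
  qed
  let ?d = "max (al + aplus S (j - 1)) (al - aminus S j)"
  have dpos: "?d > 0" using al_pos speeds(2)[OF ifaces(1)] by (simp add: less_max_iff_disj)
  have lam_le: "ennreal lam \<le> ennreal (lambda0 \<gamma> \<sigma> S j)"
    "ennreal lam \<le> ennreal \<omega> / max_rate_L \<gamma> \<sigma> f M S j"
    "ennreal lam \<le> ennreal \<omega> / max_rate_R \<gamma> \<sigma> f M S j"
  proof -
    have "lambda_rel \<gamma> \<sigma> f M S \<le> Min {ennreal (lambda0 \<gamma> \<sigma> S j),
            ennreal (weight S 1) / max_rate_L \<gamma> \<sigma> f M S j,
            ennreal (weight S 1) / max_rate_R \<gamma> \<sigma> f M S j}"
      unfolding lambda_rel_def by (rule Min_le) (use j in auto)
    with lam(2) show "ennreal lam \<le> ennreal (lambda0 \<gamma> \<sigma> S j)"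
      "ennreal lam \<le> ennreal \<omega> / max_rate_L \<gamma> \<sigma> f M S j"
      "ennreal lam \<le> ennreal \<omega> / max_rate_R \<gamma> \<sigma> f M S j"
      by (auto simp: \<omega>_def)
  qed
  \<comment> \<open>\<open>ennreal\<close> sends negative reals to 0, so the real inequality is
    recovered from \<open>lam > 0\<close>.\<close>
  have lam0: "lam \<le> lambda0 \<gamma> \<sigma> S j"
    using lam_le(1) lam(1) by (simp add: ennreal_le_iff2 split: if_splits)
  then have "lam * ?d \<le> \<sigma> * \<omega>"
    using dpos by (simp add: lambda0_def al_def[symmetric] \<omega>_def pos_le_divide_eq)
  \<comment> \<open>\<open>\<sigma> < 1\<close> provides the strict CFL inequality that
    \<open>cell_update_admissible\<close> requires.\<close>
  also have "\<dots> < \<omega>" using sigma om by simp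
  finally have "lam * ?d < \<omega>" .
  moreover have "lam * (al + aplus S (j - 1)) \<le> lam * ?d" "lam * (al - aminus S j) \<le> lam * ?d"
    using lam(1) by (intro mult_left_mono; simp)+
  ultimately have cfl: "lam * (al + aplus S (j - 1)) < \<omega>" "lam * (al - aminus S j) < \<omega>"
    by linarith+
  have "cell_avg S j \<bullet> g + c = (\<Sum>i=1..?L. weight S i * (quad_state S j i \<bullet> g + c))" for g c
    using gl(3) by (simp add: avg inner_sum_left distrib_left sum.distrib sum_distrib_right[symmetric])
  moreover have "quad_state S j i \<bullet> g + c \<ge> 0" if "i \<in> {1..?L}" "(g, c) \<in> adm_tests" for i g c
    using quad_adm[OF j that(1)] that(2) unfolding admissible_B_def admissible_iff_tests by fastforce
  ultimately have A: "cell_avg S j \<bullet> g + c \<ge> \<omega> * (?UL \<bullet> g + c) + \<omega> * (?UR \<bullet> g + c)"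
    if "(g, c) \<in> adm_tests" for g c
    using end_sum[of "\<lambda>i. quad_state S j i \<bullet> g + c"] that by (simp add: state_L_def state_R_def)
  have FR: "num_flux \<gamma> S j = flux1 \<gamma> ?UR + aminus S j *\<^sub>R (H j - ?UR)"
    unfolding H_def traces(2)[symmetric] by (intro num_flux_eq_hll(1) speeds ifaces)
  have FL: "num_flux \<gamma> S (j - 1) = flux1 \<gamma> ?UL + aplus S (j - 1) *\<^sub>R (H (j - 1) - ?UL)"
    unfolding H_def traces(1)[symmetric] by (intro num_flux_eq_hll(2) speeds ifaces)
  have W_adm: "W \<in> admissible"
    unfolding W_def update_def FR FL
  proof (rule cell_update_admissible[where \<omega> = \<omega> and al = al])
    show "?UL \<in> admissible" "?UR \<in> admissible" "mag ?UL $ 1 = mag ?UR $ 1"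
      using adm by (simp_all add: admissible_B_def)
  qed (use lam(1) in \<open>simp_all only: less_imp_le gamma al cfl A H ifaces speeds\<close>)
  \<comment> \<open>The normal field is preserved: its flux component is zero, and its jump in the
    diffusive part vanishes because both traces carry \<open>Bc\<close>.\<close>
  have "mag (quad_state S j i) $ 1 = Bc" if "i \<in> {1..?L}" for i
    using quad_adm[OF j that] by (simp add: admissible_B_def)
  then have "mag (cell_avg S j) $ 1 = Bc"
    using gl(3) by (simp add: avg mag_sum sum_distrib_right[symmetric])
  moreover have "mag (num_flux \<gamma> S i) $ 1 = 0" if "i \<in> {0..ncells S}" for i
    using tr_adm[OF that] by (simp add: num_flux_def Let_def mag1_flux1 admissible_B_def)
  ultimately have W_B: "W \<in> admissible_B Bc"
    using W_adm ifaces by (simp add: admissible_B_def W_def update_def)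
  \<comment> \<open>The suprema in the rates therefore include \<open>W\<close>, unless it equals
    the end state concerned.\<close>
  have path: "W \<in> update_path \<gamma> \<sigma> S j"
    unfolding update_path_def W_def using lam(1) lam0 by simp

  \<comment> \<open>The entropy inequality\<close>
  have rel: "rel_entropy \<gamma> (f r) U W \<ge> 0" if "U \<in> admissible_B Bc" for U
    using rel_entropy_nonneg[OF f_C2[OF r] f_deriv[OF r] f_deriv2[OF r] gamma _ W_adm] that
    by (simp add: admissible_B_def)
  have boundL: "lam * defect_L \<gamma> (f r) S j W \<le> \<omega> * rel_entropy \<gamma> (f r) ?UL W"
  proof (cases "W = ?UL")
    case True
    \<comment> \<open>The supremum excludes this point. Here the defect is minus
      \<open>diss_plus\<close> at interface \<open>j - 1\<close>, and it vanishes when the numerical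
      fluxes there are the physical ones of the trace.\<close>
    have "defect_L \<gamma> (f r) S j ?UL \<le> 0"
      using diss_plus[OF ifaces(1) r]
      unfolding traces(1)[symmetric]
      by (auto simp: defect_L_def diss_plus_def entropy_pot_def)
    with True lam(1) show ?thesis
      by (simp add: rel_entropy_def mult_nonneg_nonpos)
  next
    case False
    have "ennreal (max (defect_L \<gamma> (f r) S j W) 0) / ennreal (rel_entropy \<gamma> (f r) ?UL W)
        \<le> rate_L \<gamma> \<sigma> (f r) S j"
      unfolding rate_L_def by (rule SUP_upper) (use False path in simp)
    also have "\<dots> \<le> max_rate_L \<gamma> \<sigma> f M S j"
      unfolding max_rate_L_def by (rule Max_ge) (use r in auto)
    finally have "lam * max (defect_L \<gamma> (f r) S j W) 0 \<le> \<omega> * rel_entropy \<gamma> (f r) ?UL W"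
      using ennreal_rate_bound[OF lam(1) _ rel[OF adm(1)] om _ lam_le(2)] by simp
    moreover have "lam * defect_L \<gamma> (f r) S j W \<le> lam * max (defect_L \<gamma> (f r) S j W) 0"
      using lam(1) by (intro mult_left_mono) auto
    ultimately show ?thesis by linarith
  qed
  have boundR: "lam * defect_R \<gamma> (f r) S j W \<le> \<omega> * rel_entropy \<gamma> (f r) ?UR W"
  proof (cases "W = ?UR")
    case True
    \<comment> \<open>At the right end the defect is minus \<open>diss_minus\<close> at interface
      \<open>j\<close>.\<close>
    have "defect_R \<gamma> (f r) S j ?UR \<le> 0"
      using diss_minus[OF ifaces(2) r]
      unfolding traces(2)[symmetric]
      by (auto simp: defect_R_def diss_minus_def entropy_pot_def)
    with True lam(1) show ?thesis
      by (simp add: rel_entropy_def mult_nonneg_nonpos)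
  next
    case False
    have "ennreal (max (defect_R \<gamma> (f r) S j W) 0) / ennreal (rel_entropy \<gamma> (f r) ?UR W)
        \<le> rate_R \<gamma> \<sigma> (f r) S j"
      unfolding rate_R_def by (rule SUP_upper) (use False path in simp)
    also have "\<dots> \<le> max_rate_R \<gamma> \<sigma> f M S j"
      unfolding max_rate_R_def by (rule Max_ge) (use r in auto)
    finally have "lam * max (defect_R \<gamma> (f r) S j W) 0 \<le> \<omega> * rel_entropy \<gamma> (f r) ?UR W"
      using ennreal_rate_bound[OF lam(1) _ rel[OF adm(2)] om _ lam_le(3)] by simp
    moreover have "lam * defect_R \<gamma> (f r) S j W \<le> lam * max (defect_R \<gamma> (f r) S j W) 0"
      using lam(1) by (intro mult_left_mono) auto
    ultimately show ?thesis by linarith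
  qed
  have "eta \<gamma> (f r) W - budget \<gamma> (f r) S lam j
    = lam * (defect_L \<gamma> (f r) S j W + defect_R \<gamma> (f r) S j W)
      - (\<Sum>i=1..?L. weight S i * rel_entropy \<gamma> (f r) (quad_state S j i) W)"
    unfolding W_def by (rule entropy_balance[OF avg gl(3)])
  \<comment> \<open>The interior relative entropies are discarded; the two end terms absorb both
    boundary defects.\<close>
  moreover have "\<omega> * rel_entropy \<gamma> (f r) ?UL W + \<omega> * rel_entropy \<gamma> (f r) ?UR W
      \<le> (\<Sum>i=1..?L. weight S i * rel_entropy \<gamma> (f r) (quad_state S j i) W)"
    using end_sum[of "\<lambda>i. rel_entropy \<gamma> (f r) (quad_state S j i) W"] rel quad_adm[OF j]
    by (simp add: state_L_def state_R_def)
  ultimately have "eta \<gamma> (f r) W \<le> budget \<gamma> (f r) S lam j"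
    using boundL boundR by (simp add: distrib_left)
  with W_B show "update \<gamma> S lam j \<in> admissible_B Bc \<and>
      eta \<gamma> (f r) (update \<gamma> S lam j) \<le> budget \<gamma> (f r) S lam j"
    by (simp add: W_def)
qed

end
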